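(* Let $A\in\mathbb{R}^{m\times n}$ with $m\ge n$, $b\in\mathbb{R}^m$, let $J=\mathrm{diag}(I_p,-I_q)$ with $p+q=m$, and assume $M=A^TJA$ is positive definite. Let $x=x(A,b)=M^{-1}A^TJb$, $r=b-Ax$, let $L\in\mathbb{R}^{n\times k}$ ($k\le n$) be fixed, and set $$M_{g'}=\left[\left((Jr)^T\otimes(L^TM^{-1})\right)\Pi_{mn}-x^T\otimes(L^TM^{-1}A^TJ),\ \ L^TM^{-1}A^TJ\right].$$ Let $\Psi\in\mathbb{R}^{m\times n}$, $\beta\in\mathbb{R}^m$, $\xi\in\mathbb{R}^k$. Then the partial condition number of the indefinite least squares problem with respect to $L$ for $\mu=\nu=\infty$ (defined in the context) is $$\kappa_{\infty ILS}(A,b)=\left\|\mathrm{diag}^{\ddag}(\xi)M_{g'}\mathrm{diag}(\mathrm{vec}(\Psi,\beta))\right\|_\infty=\left\|\frac{|M_{g'}|\,|\mathrm{vec}(\Psi,\beta)|}{|\xi|}\right\|_\infty .$$ In particular, for $\Psi=A$, $\beta=b$ and $\xi=\left[\|L^Tx(A,b)\|_\infty,\dots,\|L^Tx(A,b)\|_\infty\right]^T$ one obtains the partial mixed condition number $$\kappa_{mILS}(A,b)=\frac{\left\||M_{g'}|\,|\mathrm{vec}(A,b)|\right\|_\infty}{\|L^Tx(A,b)\|_\infty},$$ and for $\Psi=A$, $\beta=b$ and $\xi=L^Tx(A,b)$ one obtains the partial componentwise condition number $$\kappa_{cILS}(A,b)=\left\|\frac{|M_{g'}|\,|\mathrm{vec}(A,b)|}{|L^Tx(A,b)|}\right\|_\infty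 .$$
   Context: The indefinite least squares (ILS) problem is $\min_{x\in\mathbb{R}^n}(b-Ax)^TJ(b-Ax)$; when $A^TJA$ is positive definite its unique solution is $x(A,b)=M^{-1}A^TJb$. Notation: for $c\in\mathbb{R}$, $c^{\ddag}=1/c$ if $c\neq 0$ and $c^{\ddag}=1$ if $c=0$. For a vector $v$, $\mathrm{diag}(v)$ is the diagonal matrix with diagonal $v$, and $\mathrm{diag}^{\ddag}(v)$ the diagonal matrix with diagonal entries $v_i^{\ddag}$. All divisions between vectors (including scalars) are entry-wise with the convention $\frac{a}{v}=\mathrm{diag}^{\ddag}(v)a$, and similarly for matrices of equal size. $|\cdot|$ applied to a matrix or vector is the entry-wise absolute value. $\|\cdot\|_\infty$ is the max norm of a vector and the induced (max row sum) norm of a matrix. $\mathrm{vec}$ stacks the columns of a matrix; $\mathrm{vec}(\Psi,\beta)$ is $\mathrm{vec}(\Psi)$ stacked on top of $\beta$ (same convention for other pairs). $\otimes$ is the Kronecker product; $\Pi_{mn}$ is the vec-permutation matrix with $\Pi_{mn}\mathrm{vec}(X)=\mathrm{vec}(X^T)$ for all $X\in\mathbb{R}^{m\times n}$. Let $g(A,b)=L^Tx(A,b)$, with Fréchet derivative $$g'(A,b)\circ(\Delta A,\Delta b)=L^TM^{-1}(\Delta A)^TJr-L^TM^{-1}A^TJ(\Delta A)x+L^TM^{-1}A^TJ\,\Delta b .$$ The partial condition number for $\mu=\nu=\infty$ is $$\kappa_{\infty ILS}(A,b)=\sup_{\left\|\mathrm{vec}\left(\frac{\Delta A}{\Psi},\frac{\Delta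 b}{\beta}\right)\right\|_\infty\neq 0}\frac{\left\|\frac{g'(A,b)\circ(\Delta A,\Delta b)}{\xi}\right\|_\infty}{\left\|\mathrm{vec}\left(\frac{\Delta A}{\Psi},\frac{\Delta b}{\beta}\right)\right\|_\infty},$$ the supremum being over $\Delta A\in\mathbb{R}^{m\times n}$, $\Delta b\in\mathbb{R}^m$, with the requirement that if some entry of $\Psi$ or $\beta$ is zero, the corresponding entry of $\Delta A$ or $\Delta b$ is zero. The mixed condition number $\kappa_{mILS}$ and componentwise condition number $\kappa_{cILS}$ are by definition the values of $\kappa_{\infty ILS}$ for the two indicated choices of $\Psi,\beta,\xi$. *)

theory Defs
  imports
    "Jordan_Normal_Form.Gauss_Jordan_Elimination"
    "HOL-Library.Extended_Nonnegative_Real"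
begin

text \<open>Inserting 0 in the next two definitions only makes the maximum meaningful in dimension 0.\<close>

definition vnorm_inf :: "real vec \<Rightarrow> real" where
  "vnorm_inf v = Max (insert 0 {\<bar>v $ i\<bar> | i. i < dim_vec v})"

definition mnorm_inf :: "real mat \<Rightarrow> real" where
  "mnorm_inf A = Max (insert 0 {\<Sum>j<dim_col A. \<bar>A $$ (i,j)\<bar> | i. i < dim_row A})"

definition ddag :: "real \<Rightarrow> real" where
  "ddag c = (if c = 0 then 1 else 1 / c)"

definition diag_vec :: "real vec \<Rightarrow> real mat" where
  "diag_vec v = mat_diag (dim_vec v) (\<lambda>i. v $ i)"

definition diag_ddag :: "real vec \<Rightarrow> real mat" where
  "diag_ddag v = mat_diag (dim_vec v) (\<lambda>i. ddag (v $ i))"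

definition vec_divide :: "real vec \<Rightarrow> real vec \<Rightarrow> real vec" where
  "vec_divide a v = diag_ddag v *\<^sub>v a"

definition mat_divide :: "real mat \<Rightarrow> real mat \<Rightarrow> real mat" where
  "mat_divide X Y = mat (dim_row X) (dim_col X) (\<lambda>(i,j). ddag (Y $$ (i,j)) * X $$ (i,j))"

definition scalar_divide :: "real \<Rightarrow> real \<Rightarrow> real" where
  "scalar_divide a c = ddag c * a"

definition vec_of_mat :: "'a mat \<Rightarrow> 'a vec" where
  "vec_of_mat X = vec (dim_row X * dim_col X) (\<lambda>l. X $$ (l mod dim_row X, l div dim_row X))"

definition vec_pair :: "'a mat \<Rightarrow> 'a vec \<Rightarrow> 'a vec" where
  "vec_pair X y = vec_of_mat X @\<^sub>v y"

definition kronecker :: "real mat \<Rightarrow> real mat \<Rightarrow> real mat" where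
  "kronecker A B = mat (dim_row A * dim_row B) (dim_col A * dim_col B)
     (\<lambda>(i,j). A $$ (i div dim_row B, j div dim_col B) * B $$ (i mod dim_row B, j mod dim_col B))"

text \<open>For an \<open>m\<close> by \<open>n\<close> matrix \<open>X\<close>, the entry \<open>X $$ (i,j)\<close> sits at position \<open>j * m + i\<close> of
  \<open>vec_of_mat X\<close> and at position \<open>i * n + j\<close> of \<open>vec_of_mat (transpose_mat X)\<close>.\<close>

definition vec_perm_mat :: "nat \<Rightarrow> nat \<Rightarrow> real mat" where
  "vec_perm_mat m n = mat (m * n) (m * n)
     (\<lambda>(a,c). if c = (a mod n) * m + a div n then 1 else 0)"

lemma vec_perm_mat_vec_of_mat:
  assumes X: "X \<in> carrier_mat m n"
  shows "vec_perm_mat m n *\<^sub>v vec_of_mat X = vec_of_mat (transpose_mat X)"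
proof (rule eq_vecI)
  show "dim_vec (vec_perm_mat m n *\<^sub>v vec_of_mat X) = dim_vec (vec_of_mat (transpose_mat X))"
    using X by (simp add: vec_perm_mat_def vec_of_mat_def mult.commute)
next
  fix a assume "a < dim_vec (vec_of_mat (transpose_mat X))"
  then have a: "a < m * n" using X by (simp add: vec_of_mat_def mult.commute)
  then have n: "n > 0" by (cases n) auto
  define i j where "i = a div n" and "j = a mod n"
  have i: "i < m" using a unfolding i_def by (simp add: less_mult_imp_div_less)
  have j: "j < n" using n unfolding j_def by simp
  have "j * m + i < (j + 1) * m" using i by simp
  also have "\<dots> \<le> n * m" using j by (intro mult_right_mono) auto
  finally have c: "j * m + i < m * n" by (simp add: mult.commute)
  have "(vec_perm_mat m n *\<^sub>v vec_of_mat X) $ a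
      = (\<Sum>c\<in>{0..<m * n}. (if c = j * m + i then 1 else 0) * X $$ (c mod m, c div m))"
    using a X by (simp add: vec_perm_mat_def vec_of_mat_def scalar_prod_def i_def j_def)
  also have "\<dots> = (\<Sum>c\<in>{0..<m * n}. if c = j * m + i then X $$ (c mod m, c div m) else 0)"
    by (intro sum.cong) auto
  also have "\<dots> = X $$ ((j * m + i) mod m, (j * m + i) div m)"
    using c by simp
  also have "\<dots> = X $$ (i, j)" using i by simp
  also have "\<dots> = vec_of_mat (transpose_mat X) $ a"
    using a i j X by (simp add: vec_of_mat_def mult.commute i_def j_def)
  finally show "(vec_perm_mat m n *\<^sub>v vec_of_mat X) $ a = vec_of_mat (transpose_mat X) $ a" .
qed

definition append_cols :: "real mat \<Rightarrow> real mat \<Rightarrow> real mat" where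
  "append_cols A B = mat (dim_row A) (dim_col A + dim_col B)
     (\<lambda>(i,j). if j < dim_col A then A $$ (i,j) else B $$ (i, j - dim_col A))"

definition pos_def_mat :: "real mat \<Rightarrow> bool" where
  "pos_def_mat M \<longleftrightarrow> square_mat M \<and> transpose_mat M = M \<and>
     (\<forall>v \<in> carrier_vec (dim_row M). v \<noteq> 0\<^sub>v (dim_row M) \<longrightarrow> v \<bullet> (M *\<^sub>v v) > 0)"

definition signature_mat :: "nat \<Rightarrow> nat \<Rightarrow> real mat" where
  "signature_mat p q = four_block_mat (1\<^sub>m p) (0\<^sub>m p q) (0\<^sub>m q p) (- (1\<^sub>m q))"

definition ils_M :: "real mat \<Rightarrow> real mat \<Rightarrow> real mat" where
  "ils_M J A = transpose_mat A * J * A"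

definition ils_Minv :: "real mat \<Rightarrow> real mat \<Rightarrow> real mat" where
  "ils_Minv J A = the (mat_inverse (ils_M J A))"

definition ils_x :: "real mat \<Rightarrow> real mat \<Rightarrow> real vec \<Rightarrow> real vec" where
  "ils_x J A b = (ils_Minv J A * transpose_mat A * J) *\<^sub>v b"

definition ils_r :: "real mat \<Rightarrow> real mat \<Rightarrow> real vec \<Rightarrow> real vec" where
  "ils_r J A b = b - A *\<^sub>v ils_x J A b"

definition ils_g :: "real mat \<Rightarrow> real mat \<Rightarrow> real mat \<Rightarrow> real vec \<Rightarrow> real vec" where
  "ils_g J L A b = transpose_mat L *\<^sub>v ils_x J A b"

definition ils_Mg' :: "real mat \<Rightarrow> real mat \<Rightarrow> real mat \<Rightarrow> real vec \<Rightarrow> real mat" where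
  "ils_Mg' J L A b =
     (let K = transpose_mat L * ils_Minv J A; N = K * transpose_mat A * J in
      append_cols
        (kronecker (mat_of_row (J *\<^sub>v ils_r J A b)) K * vec_perm_mat (dim_row A) (dim_col A)
           - kronecker (mat_of_row (ils_x J A b)) N)
        N)"

text \<open>Frechet derivative of a function of a matrix and a vector. The matrix and vector types carry
  no norm, so the usual definition is spelled out, with the max norm on both sides (all norms
  being equivalent in finite dimension). Linear maps are relevant on the carriers only.\<close>

definition has_frechet_derivative ::
    "(real mat \<Rightarrow> real vec \<Rightarrow> real vec) \<Rightarrow> (real mat \<Rightarrow> real vec \<Rightarrow> real vec)
       \<Rightarrow> real mat \<Rightarrow> real vec \<Rightarrow> bool" where
  "has_frechet_derivative f D A b \<longleftrightarrow>
    (let CA = carrier_mat (dim_row A) (dim_col A); Cb = carrier_vec (dim_vec b);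
         k = dim_vec (f A b) in
      (\<forall>X\<in>CA. \<forall>y\<in>Cb. D X y \<in> carrier_vec k) \<and>
      (\<forall>X\<in>CA. \<forall>y\<in>Cb. \<forall>X'\<in>CA. \<forall>y'\<in>Cb. D (X + X') (y + y') = D X y + D X' y') \<and>
      (\<forall>X\<in>CA. \<forall>y\<in>Cb. \<forall>c. D (c \<cdot>\<^sub>m X) (c \<cdot>\<^sub>v y) = c \<cdot>\<^sub>v D X y) \<and>
      (\<forall>e>0. \<exists>d>0. \<forall>X\<in>CA. \<forall>y\<in>Cb. vnorm_inf (vec_pair X y) < d \<longrightarrow>
         vnorm_inf (f (A + X) (b + y) - f A b - D X y) \<le> e * vnorm_inf (vec_pair X y)))"

text \<open>On the carriers the derivative is unique if it exists.\<close>

definition frechet_deriv ::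
    "(real mat \<Rightarrow> real vec \<Rightarrow> real vec) \<Rightarrow> real mat \<Rightarrow> real vec \<Rightarrow> real mat \<Rightarrow> real vec \<Rightarrow> real vec" where
  "frechet_deriv f A b = (SOME D. has_frechet_derivative f D A b)"

definition admissible_pert :: "real mat \<Rightarrow> real vec \<Rightarrow> (real mat \<times> real vec) set" where
  "admissible_pert \<Psi> \<beta> =
     {(X, y). X \<in> carrier_mat (dim_row \<Psi>) (dim_col \<Psi>) \<and> y \<in> carrier_vec (dim_vec \<beta>) \<and>
        (\<forall>i<dim_row \<Psi>. \<forall>j<dim_col \<Psi>. \<Psi> $$ (i,j) = 0 \<longrightarrow> X $$ (i,j) = 0) \<and>
        (\<forall>i<dim_vec \<beta>. \<beta> $ i = 0 \<longrightarrow> y $ i = 0) \<and>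
        vnorm_inf (vec_pair (mat_divide X \<Psi>) (vec_divide y \<beta>)) \<noteq> 0}"

text \<open>The supremum is taken in the nonnegative extended reals: it exists without any boundedness
  assumption, and it is 0 when \<open>\<Psi>\<close> and \<open>\<beta>\<close> vanish, so that no perturbation is admissible.\<close>

definition kappa_inf_ILS ::
    "real mat \<Rightarrow> real mat \<Rightarrow> real mat \<Rightarrow> real vec \<Rightarrow> real vec \<Rightarrow> real mat \<Rightarrow> real vec \<Rightarrow> ennreal" where
  "kappa_inf_ILS J L \<Psi> \<beta> \<xi> A b =
     (SUP (X, y) \<in> admissible_pert \<Psi> \<beta>.
        ennreal (vnorm_inf (vec_divide (frechet_deriv (ils_g J L) A b X y) \<xi>)
                 / vnorm_inf (vec_pair (mat_divide X \<Psi>) (vec_divide y \<beta>))))"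

definition kappa_m_ILS :: "real mat \<Rightarrow> real mat \<Rightarrow> real mat \<Rightarrow> real vec \<Rightarrow> ennreal" where
  "kappa_m_ILS J L A b =
     kappa_inf_ILS J L A b (vec (dim_col L) (\<lambda>_. vnorm_inf (transpose_mat L *\<^sub>v ils_x J A b))) A b"

definition kappa_c_ILS :: "real mat \<Rightarrow> real mat \<Rightarrow> real mat \<Rightarrow> real vec \<Rightarrow> ennreal" where
  "kappa_c_ILS J L A b = kappa_inf_ILS J L A b (transpose_mat L *\<^sub>v ils_x J A b) A b"

abbreviation mabs :: "real mat \<Rightarrow> real mat" where "mabs \<equiv> map_mat abs"
abbreviation vabs :: "real vec \<Rightarrow> real vec" where "vabs \<equiv> map_vec abs"

end

theory Submission
  imports Defs "Jordan_Normal_Form.Determinant"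
begin

text \<open>Since \<open>M\<close> is nonsingular, subtracting the normal equations of the original and the perturbed
  problem and absorbing the change of \<open>M\<close> on the left shows both that the perturbed problem stays
  nonsingular and that the Frechet derivative of \<open>g\<close> is \<open>vec(X, y) \<mapsto> M_g' vec(X, y)\<close>. Writing an
  admissible perturbation as \<open>vec(X, y) = diag(vec(\<Psi>, \<beta>)) w\<close>, the condition number becomes the
  maximum norm of the matrix \<open>diag\<^sup>\<ddagger>(\<xi>) M_g' diag(vec(\<Psi>, \<beta>))\<close>; a vector \<open>w\<close> of signs of a
  maximal row vanishes where \<open>vec(\<Psi>, \<beta>)\<close> does, so the constraint on the zero entries does not
  lower the supremum.\<close>

text \<open>\<open>frechet_deriv\<close> is a choice among all maps with the derivative property, so
  its values follow only from an explicit derivative together with uniqueness on the carriers. For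
  differentiability the inverse of the perturbed M is neither expanded nor estimated. With mu the
  norm of M^-1, the bound |v| <= mu |M v| is combined with the fact that M changes by O(h) under a
  perturbation of size h: for small h the resulting term is at most |v| / 2. This is applied to a
  kernel vector of the perturbed M, which must then vanish, and to the change z of the solution,
  which is then O(h). The original normal equation A^T J r = 0 removes the term of order zero. The
  first-order part is X^T J r + A^T J (y - X x), and M^-1 turns it into the known derivative. Each
  remaining term has two small factors: X with y - X x, or the change of M with z. Hence the
  remainder is O(h^2).\<close>

section \<open>Max norm of vectors and row-sum norm of matrices\<close>

lemma vnorm_inf_le_iff:
  "0 \<le> c \<Longrightarrow> vnorm_inf v \<le> c \<longleftrightarrow> (\<forall>i<dim_vec v. \<bar>v $ i\<bar> \<le> c)"
  unfolding vnorm_inf_def by (subst Max_le_iff) auto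

lemma vnorm_inf_nonneg [simp]: "0 \<le> vnorm_inf v"
  unfolding vnorm_inf_def by (rule Max_ge) auto

lemma abs_index_le_vnorm_inf: "i < dim_vec v \<Longrightarrow> \<bar>v $ i\<bar> \<le> vnorm_inf v"
  using vnorm_inf_le_iff[of "vnorm_inf v" v] by simp

lemma mnorm_inf_le_iff:
  "0 \<le> c \<Longrightarrow> mnorm_inf A \<le> c \<longleftrightarrow> (\<forall>i<dim_row A. (\<Sum>j<dim_col A. \<bar>A $$ (i,j)\<bar>) \<le> c)"
  unfolding mnorm_inf_def by (subst Max_le_iff) auto

lemma mnorm_inf_nonneg [simp]: "0 \<le> mnorm_inf A"
  unfolding mnorm_inf_def by (rule Max_ge) auto

lemma row_sum_le_mnorm_inf:
  "i < dim_row A \<Longrightarrow> (\<Sum>j<dim_col A. \<bar>A $$ (i,j)\<bar>) \<le> mnorm_inf A"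
  using mnorm_inf_le_iff[of "mnorm_inf A" A] by simp

text \<open>A nonzero value cannot be the inserted 0 of the definition, so the maximum comes from an
  actual row.\<close>

lemma mnorm_inf_attained:
  assumes "mnorm_inf A \<noteq> 0"
  obtains i where "i < dim_row A" "mnorm_inf A = (\<Sum>j<dim_col A. \<bar>A $$ (i,j)\<bar>)"
proof -
  have "mnorm_inf A \<in> insert 0 {\<Sum>j<dim_col A. \<bar>A $$ (i,j)\<bar> | i. i < dim_row A}"
    unfolding mnorm_inf_def by (rule Max_in) auto
  then show thesis using assms that by auto
qed

lemma index_mult_mat_vec_sum:
  assumes "i < dim_row A" "dim_vec v = dim_col A"
  shows "(A *\<^sub>v v) $ i = (\<Sum>j<dim_col A. A $$ (i,j) * v $ j)"
  using assms by (simp add: scalar_prod_def atLeast0LessThan)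

lemma vnorm_inf_mult_mat_vec:
  assumes "dim_vec v = dim_col A"
  shows "vnorm_inf (A *\<^sub>v v) \<le> mnorm_inf A * vnorm_inf v"
proof (subst vnorm_inf_le_iff, simp, intro allI impI)
  fix i assume "i < dim_vec (A *\<^sub>v v)"
  then have i: "i < dim_row A" by simp
  have "\<bar>(A *\<^sub>v v) $ i\<bar> \<le> (\<Sum>j<dim_col A. \<bar>A $$ (i,j) * v $ j\<bar>)"
    unfolding index_mult_mat_vec_sum[OF i assms] by (rule sum_abs)
  also have "\<dots> \<le> (\<Sum>j<dim_col A. \<bar>A $$ (i,j)\<bar> * vnorm_inf v)"
    using assms by (intro sum_mono) (auto simp: abs_mult intro!: mult_left_mono abs_index_le_vnorm_inf)
  also have "\<dots> \<le> mnorm_inf A * vnorm_inf v"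
    unfolding sum_distrib_right[symmetric] by (intro mult_right_mono row_sum_le_mnorm_inf i) simp
  finally show "\<bar>(A *\<^sub>v v) $ i\<bar> \<le> mnorm_inf A * vnorm_inf v" .
qed

lemma vnorm_inf_add:
  assumes "v \<in> carrier_vec n" "w \<in> carrier_vec n"
  shows "vnorm_inf (v + w) \<le> vnorm_inf v + vnorm_inf w"
proof (subst vnorm_inf_le_iff, simp, intro allI impI)
  fix i assume "i < dim_vec (v + w)"
  then show "\<bar>(v + w) $ i\<bar> \<le> vnorm_inf v + vnorm_inf w"
    using assms abs_index_le_vnorm_inf[of i v] abs_index_le_vnorm_inf[of i w] by simp
qed

lemma vnorm_inf_diff:
  assumes "v \<in> carrier_vec n" "w \<in> carrier_vec n"
  shows "vnorm_inf (v - w) \<le> vnorm_inf v + vnorm_inf w"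
proof (subst vnorm_inf_le_iff, simp, intro allI impI)
  fix i assume "i < dim_vec (v - w)"
  then show "\<bar>(v - w) $ i\<bar> \<le> vnorm_inf v + vnorm_inf w"
    using assms abs_index_le_vnorm_inf[of i v] abs_index_le_vnorm_inf[of i w] by simp
qed

lemma vnorm_inf_smult: "vnorm_inf (c \<cdot>\<^sub>v v) = \<bar>c\<bar> * vnorm_inf v"
proof -
  have le: "vnorm_inf (c \<cdot>\<^sub>v v) \<le> \<bar>c\<bar> * vnorm_inf v" for c v
    by (subst vnorm_inf_le_iff)
      (auto simp: abs_mult intro!: mult_left_mono abs_index_le_vnorm_inf)
  show ?thesis
  proof (cases "c = 0")
    case True
    then show ?thesis using le[of c v] by (simp add: antisym)
  next
    case False
    \<comment> \<open>The reverse inequality is the bound \<open>le\<close> applied to the inverse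
      scalar.\<close>
    then have "v = inverse c \<cdot>\<^sub>v (c \<cdot>\<^sub>v v)" by (simp add: smult_smult_assoc)
    then have "vnorm_inf v \<le> \<bar>inverse c\<bar> * vnorm_inf (c \<cdot>\<^sub>v v)" using le by metis
    then have "\<bar>c\<bar> * vnorm_inf v \<le> vnorm_inf (c \<cdot>\<^sub>v v)"
      using False by (simp add: field_simps)
    with le show ?thesis by (simp add: antisym)
  qed
qed

lemma vnorm_inf_zero_iff: "vnorm_inf v = 0 \<longleftrightarrow> v = 0\<^sub>v (dim_vec v)"
proof -
  have "vnorm_inf v = 0 \<longleftrightarrow> vnorm_inf v \<le> 0" using vnorm_inf_nonneg[of v] by linarith
  also have "\<dots> \<longleftrightarrow> v = 0\<^sub>v (dim_vec v)" by (subst vnorm_inf_le_iff) (auto simp: vec_eq_iff)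
  finally show ?thesis .
qed

section \<open>Stacking a matrix and a vector into one vector\<close>

lemma vec_of_mat_carrier [simp]: "X \<in> carrier_mat m n \<Longrightarrow> vec_of_mat X \<in> carrier_vec (n * m)"
  by (auto simp: vec_of_mat_def mult.commute)

lemma column_major_index_less:
  fixes i j m n :: nat
  assumes "i < m" "j < n"
  shows "j * m + i < n * m"
proof -
  have "j * m + i < Suc j * m" using assms by simp
  also have "\<dots> \<le> n * m" using assms by (intro mult_right_mono) auto
  finally show ?thesis .
qed

lemma vec_of_mat_index:
  assumes "X \<in> carrier_mat m n" "i < m" "j < n"
  shows "vec_of_mat X $ (j * m + i) = X $$ (i,j)"
  using column_major_index_less[OF assms(2,3)] assms by (simp add: vec_of_mat_def mult.commute)

lemma dim_vec_pair [simp]: "dim_vec (vec_pair X y) = dim_col X * dim_row X + dim_vec y"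
  by (simp add: vec_pair_def vec_of_mat_def mult.commute)

lemma vec_pair_carrier [simp]:
  "X \<in> carrier_mat m n \<Longrightarrow> y \<in> carrier_vec l \<Longrightarrow> vec_pair X y \<in> carrier_vec (n * m + l)"
  by (simp add: vec_pair_def)

lemma vec_pair_index:
  assumes "X \<in> carrier_mat m n" "y \<in> carrier_vec l"
  shows "i < m \<Longrightarrow> j < n \<Longrightarrow> vec_pair X y $ (j * m + i) = X $$ (i,j)"
    and "i < l \<Longrightarrow> vec_pair X y $ (n * m + i) = y $ i"
proof -
  have d: "dim_vec (vec_of_mat X) = n * m" using assms by (simp add: vec_of_mat_def mult.commute)
  show "vec_pair X y $ (j * m + i) = X $$ (i,j)" if "i < m" "j < n"
    using column_major_index_less[OF that] vec_of_mat_index[OF assms(1) that]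
    by (simp add: vec_pair_def d)
  show "vec_pair X y $ (n * m + i) = y $ i" if "i < l"
    using that assms by (simp add: vec_pair_def d)
qed

text \<open>Inverts the column-major numbering: below \<open>n * m\<close>, division with remainder
  by \<open>m\<close> returns column and row; the positions from \<open>n * m\<close> on belong to
  the vector part.\<close>

lemma vec_pair_index_cases:
  fixes m n l s :: nat
  assumes "s < n * m + l"
  obtains i j where "i < m" "j < n" "s = j * m + i"
  | i where "i < l" "s = n * m + i"
proof (cases "s < n * m")
  case True
  then have "m > 0" by (cases m) auto
  then have "s mod m < m" "s div m < n" "s = s div m * m + s mod m"
    using True by (simp_all add: less_mult_imp_div_less)
  then show ?thesis using that(1) by blast
next
  case False
  then show ?thesis using that(2)[of "s - n * m"] assms by simp
qed

text \<open>Serves as extensionality for stacked vectors: linearity, division and surjectivity of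
  \<open>vec_pair\<close> all reduce to separate entrywise checks on the two parts.\<close>

lemma vec_eq_vec_pairI:
  assumes "X \<in> carrier_mat m n" "y \<in> carrier_vec l" "v \<in> carrier_vec (n * m + l)"
    and "\<And>i j. i < m \<Longrightarrow> j < n \<Longrightarrow> v $ (j * m + i) = X $$ (i,j)"
    and "\<And>i. i < l \<Longrightarrow> v $ (n * m + i) = y $ i"
  shows "v = vec_pair X y"
proof (rule eq_vecI)
  have d: "dim_vec (vec_pair X y) = n * m + l" using assms(1,2) by simp
  then show "dim_vec v = dim_vec (vec_pair X y)" using carrier_vecD[OF assms(3)] by simp
  fix s assume "s < dim_vec (vec_pair X y)"
  then have "s < n * m + l" using d by simp
  then show "v $ s = vec_pair X y $ s"
    by (cases rule: vec_pair_index_cases) (use assms in \<open>simp_all add: vec_pair_index\<close>)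
qed

text \<open>Turns the extremal vector built in the supremum argument back into a perturbation of the
  data.\<close>

lemma vec_pair_surj:
  assumes "v \<in> carrier_vec (n * m + l)"
  obtains X y where "X \<in> carrier_mat m n" "y \<in> carrier_vec l" "vec_pair X y = v"
proof -
  let ?X = "mat m n (\<lambda>(i,j). v $ (j * m + i))" and ?y = "vec l (\<lambda>i. v $ (n * m + i))"
  have "v = vec_pair ?X ?y" by (rule vec_eq_vec_pairI) (use assms in auto)
  then show thesis using that[of ?X ?y] by simp
qed

lemma vec_pair_add:
  assumes "X \<in> carrier_mat m n" "y \<in> carrier_vec l" "X' \<in> carrier_mat m n" "y' \<in> carrier_vec l"
  shows "vec_pair (X + X') (y + y') = vec_pair X y + vec_pair X' y'"
proof (rule vec_eq_vec_pairI[symmetric])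
  show "vec_pair X y + vec_pair X' y' \<in> carrier_vec (n * m + l)" using assms by simp
qed (use assms in \<open>auto simp: vec_pair_index column_major_index_less trans_less_add1\<close>)

lemma vec_pair_smult:
  assumes "X \<in> carrier_mat m n" "y \<in> carrier_vec l"
  shows "vec_pair (c \<cdot>\<^sub>m X) (c \<cdot>\<^sub>v y) = c \<cdot>\<^sub>v vec_pair X y"
proof (rule vec_eq_vec_pairI[symmetric])
  show "c \<cdot>\<^sub>v vec_pair X y \<in> carrier_vec (n * m + l)" using assms by simp
qed (use assms in \<open>auto simp: vec_pair_index column_major_index_less trans_less_add1\<close>)

lemma abs_index_le_vnorm_inf_vec_pair:
  assumes "X \<in> carrier_mat m n" "y \<in> carrier_vec l" "i < m" "j < n"
  shows "\<bar>X $$ (i,j)\<bar> \<le> vnorm_inf (vec_pair X y)"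
  using abs_index_le_vnorm_inf[of "j * m + i" "vec_pair X y"] assms(1,2)
    vec_pair_index(1)[OF assms] column_major_index_less[OF assms(3,4)] by simp

lemma vnorm_inf_le_vnorm_inf_vec_pair:
  assumes "X \<in> carrier_mat m n" "y \<in> carrier_vec l"
  shows "vnorm_inf y \<le> vnorm_inf (vec_pair X y)"
proof (subst vnorm_inf_le_iff, simp, intro allI impI)
  fix i assume "i < dim_vec y"
  then show "\<bar>y $ i\<bar> \<le> vnorm_inf (vec_pair X y)"
    using abs_index_le_vnorm_inf[of "n * m + i" "vec_pair X y"] vec_pair_index(2)[OF assms, of i] assms by simp
qed

lemma mnorm_inf_le_dim_col:
  assumes "X \<in> carrier_mat m n" "0 \<le> h" "\<And>i j. i < m \<Longrightarrow> j < n \<Longrightarrow> \<bar>X $$ (i,j)\<bar> \<le> h"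
  shows "mnorm_inf X \<le> n * h"
proof (subst mnorm_inf_le_iff)
  show "\<forall>i<dim_row X. (\<Sum>j<dim_col X. \<bar>X $$ (i,j)\<bar>) \<le> n * h"
  proof (intro allI impI)
    fix i assume "i < dim_row X"
    then have "(\<Sum>j<dim_col X. \<bar>X $$ (i,j)\<bar>) \<le> (\<Sum>j<dim_col X. h)"
      using assms by (intro sum_mono) auto
    then show "(\<Sum>j<dim_col X. \<bar>X $$ (i,j)\<bar>) \<le> n * h" using assms by simp
  qed
qed (use assms in simp)

text \<open>The size of a perturbation is its largest entry, whereas products are estimated by row
  sums. The price is the row length, which is \<open>n\<close> for \<open>X\<close> and
  \<open>m\<close> for its transpose.\<close>

lemma mnorm_inf_le_vnorm_inf_vec_pair:
  assumes "X \<in> carrier_mat m n" "y \<in> carrier_vec l"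
  shows "mnorm_inf X \<le> n * vnorm_inf (vec_pair X y)"
    and "mnorm_inf (transpose_mat X) \<le> m * vnorm_inf (vec_pair X y)"
proof -
  show "mnorm_inf X \<le> n * vnorm_inf (vec_pair X y)"
    using abs_index_le_vnorm_inf_vec_pair[OF assms] by (intro mnorm_inf_le_dim_col[OF assms(1)]) auto
  show "mnorm_inf (transpose_mat X) \<le> m * vnorm_inf (vec_pair X y)"
    using assms abs_index_le_vnorm_inf_vec_pair[OF assms]
    by (intro mnorm_inf_le_dim_col[where m = n]) auto
qed

section \<open>Kronecker products and the action of \<open>ils_Mg'\<close> on a stacked
  perturbation\<close>

lemma sum_lessThan_mult:
  fixes f :: "nat \<Rightarrow> 'a::comm_monoid_add"
  shows "(\<Sum>s<n * m. f s) = (\<Sum>j<n. \<Sum>i<m. f (j * m + i))"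
proof -
  have "(\<Sum>s<n * m. f s) = (\<Sum>j<n. sum f {j * m..<j * m + m})"
    by (rule sum.nat_group[symmetric])
  also have "\<dots> = (\<Sum>j<n. \<Sum>i<m. f (j * m + i))"
    by (simp add: sum.atLeastLessThan_shift_0[of f "_ * m"] atLeast0LessThan)
  finally show ?thesis .
qed

text \<open>This is the identity (B^T kron K) vec(Z) = vec(K Z B) for a single column B = u, where
  the outer vec disappears. Splitting the sum over positions into columns of \<open>Z\<close> and
  swapping the two sums exposes the entries of \<open>Z u\<close>.\<close>

lemma kronecker_row_mult_vec_of_mat:
  assumes "u \<in> carrier_vec c" "K \<in> carrier_mat k a" "Z \<in> carrier_mat a c"
  shows "kronecker (mat_of_row u) K *\<^sub>v vec_of_mat Z = K *\<^sub>v (Z *\<^sub>v u)"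
proof (rule eq_vecI)
  show "dim_vec (kronecker (mat_of_row u) K *\<^sub>v vec_of_mat Z) = dim_vec (K *\<^sub>v (Z *\<^sub>v u))"
    using assms by (simp add: kronecker_def mat_of_row_def)
  fix i assume "i < dim_vec (K *\<^sub>v (Z *\<^sub>v u))"
  then have i: "i < k" using assms by simp
  have d: "dim_row (kronecker (mat_of_row u) K) = k" "dim_col (kronecker (mat_of_row u) K) = c * a"
    "dim_vec (vec_of_mat Z) = c * a"
    using assms by (simp_all add: kronecker_def mat_of_row_def vec_of_mat_def mult.commute)
  have "(kronecker (mat_of_row u) K *\<^sub>v vec_of_mat Z) $ i
      = (\<Sum>s<c * a. kronecker (mat_of_row u) K $$ (i,s) * vec_of_mat Z $ s)"
    using i d by (subst index_mult_mat_vec_sum) auto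
  also have "\<dots> = (\<Sum>q<c. \<Sum>t<a. kronecker (mat_of_row u) K $$ (i, q * a + t) * vec_of_mat Z $ (q * a + t))"
    by (rule sum_lessThan_mult)
  also have "\<dots> = (\<Sum>q<c. \<Sum>t<a. K $$ (i,t) * (Z $$ (t,q) * u $ q))"
  proof (intro sum.cong refl)
    fix q t assume "q \<in> {..<c}" "t \<in> {..<a}"
    then have qt: "q < c" "t < a" by auto
    have "kronecker (mat_of_row u) K $$ (i, q * a + t) = u $ q * K $$ (i,t)"
      using assms i qt column_major_index_less[OF qt(2,1)]
      by (simp add: kronecker_def mat_of_row_def)
    then show "kronecker (mat_of_row u) K $$ (i, q * a + t) * vec_of_mat Z $ (q * a + t)
        = K $$ (i,t) * (Z $$ (t,q) * u $ q)"
      using vec_of_mat_index[OF assms(3) qt(2,1)] by simp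
  qed
  also have "\<dots> = (\<Sum>t<a. \<Sum>q<c. K $$ (i,t) * (Z $$ (t,q) * u $ q))"
    by (rule sum.swap)
  also have "\<dots> = (\<Sum>t<a. K $$ (i,t) * (Z *\<^sub>v u) $ t)"
    using assms by (intro sum.cong refl) (subst index_mult_mat_vec_sum, auto simp: sum_distrib_left)
  also have "\<dots> = (K *\<^sub>v (Z *\<^sub>v u)) $ i"
    using assms i by (subst index_mult_mat_vec_sum[of i]) auto
  finally show "(kronecker (mat_of_row u) K *\<^sub>v vec_of_mat Z) $ i = (K *\<^sub>v (Z *\<^sub>v u)) $ i" .
qed

lemma append_cols_mult_append_vec:
  assumes "B \<in> carrier_mat k a" "C \<in> carrier_mat k c" "v \<in> carrier_vec a" "w \<in> carrier_vec c"
  shows "append_cols B C *\<^sub>v (v @\<^sub>v w) = B *\<^sub>v v + C *\<^sub>v w"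
proof (rule eq_vecI)
  show "dim_vec (append_cols B C *\<^sub>v (v @\<^sub>v w)) = dim_vec (B *\<^sub>v v + C *\<^sub>v w)"
    using assms by (simp add: append_cols_def)
  fix i assume "i < dim_vec (B *\<^sub>v v + C *\<^sub>v w)"
  then have i: "i < k" using assms by simp
  then have "row (append_cols B C) i = row B i @\<^sub>v row C i"
    using assms by (intro eq_vecI) (auto simp: append_cols_def)
  moreover have "dim_row (append_cols B C) = k" using assms by (simp add: append_cols_def)
  ultimately show "(append_cols B C *\<^sub>v (v @\<^sub>v w)) $ i = (B *\<^sub>v v + C *\<^sub>v w) $ i"
    using i assms by (simp add: scalar_prod_append[of _ a _ c])
qed

text \<open>Identifies the matrix of Kronecker products with the derivative formula, with K = L^T
  M^-1 factored out. In this form the bracket is exactly the first-order part that the normal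
  equations produce.\<close>

lemma ils_Mg'_mult_vec_pair:
  fixes J L A :: "real mat" and b :: "real vec"
  defines "K \<equiv> transpose_mat L * ils_Minv J A"
  assumes A: "A \<in> carrier_mat m n" and J: "J \<in> carrier_mat m m" and L: "L \<in> carrier_mat n k"
    and Mi: "ils_Minv J A \<in> carrier_mat n n" and b: "b \<in> carrier_vec m"
    and X: "X \<in> carrier_mat m n" and y: "y \<in> carrier_vec m"
  shows "ils_Mg' J L A b *\<^sub>v vec_pair X y
    = K *\<^sub>v ((transpose_mat X * J) *\<^sub>v ils_r J A b + (transpose_mat A * J) *\<^sub>v (y - X *\<^sub>v ils_x J A b))"
proof -
  define N where "N = K * transpose_mat A * J"
  define x where "x = ils_x J A b"
  define r where "r = ils_r J A b"
  have K: "K \<in> carrier_mat k n" unfolding K_def using L Mi by simp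
  have AJ: "transpose_mat A * J \<in> carrier_mat n m" and XJ: "transpose_mat X * J \<in> carrier_mat n m"
    using A J X by simp_all
  have N: "N \<in> carrier_mat k m" unfolding N_def using K A J by simp
  have x: "x \<in> carrier_vec n" unfolding x_def ils_x_def
    using Mi A J b by (intro mult_mat_vec_carrier[of _ n m] mult_carrier_mat[of _ n m] mult_carrier_mat[of _ n n]) auto
  have r: "r \<in> carrier_vec m" unfolding r_def ils_r_def using A b x x_def by simp
  have Jr: "J *\<^sub>v r \<in> carrier_vec m" using J r by simp
  let ?P = "kronecker (mat_of_row (J *\<^sub>v r)) K" and ?V = "vec_perm_mat m n"
    and ?Q = "kronecker (mat_of_row x) N"
  have P: "?P \<in> carrier_mat k (m * n)" and Q: "?Q \<in> carrier_mat k (m * n)"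
    using K N x J r by (auto simp: kronecker_def mat_of_row_def mult.commute)
  have V: "?V \<in> carrier_mat (m * n) (m * n)" by (simp add: vec_perm_mat_def)
  have vX: "vec_of_mat X \<in> carrier_vec (m * n)" using X by (metis mult.commute vec_of_mat_carrier)
  \<comment> \<open>The permutation replaces vec(X) by vec(X^T), so the Kronecker identity applies
    with \<open>Z\<close> the transpose of \<open>X\<close>.\<close>
  have "(?P * ?V) *\<^sub>v vec_of_mat X = ?P *\<^sub>v vec_of_mat (transpose_mat X)"
    using assoc_mult_mat_vec[OF P V vX] vec_perm_mat_vec_of_mat[OF X] by simp
  also have "\<dots> = K *\<^sub>v (transpose_mat X *\<^sub>v (J *\<^sub>v r))"
    using X by (intro kronecker_row_mult_vec_of_mat[OF Jr K]) simp
  also have "transpose_mat X *\<^sub>v (J *\<^sub>v r) = (transpose_mat X * J) *\<^sub>v r"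
    using X J r by (simp add: assoc_mult_mat_vec[of _ n m _ m])
  finally have PV: "(?P * ?V) *\<^sub>v vec_of_mat X = K *\<^sub>v ((transpose_mat X * J) *\<^sub>v r)" .
  have QX: "?Q *\<^sub>v vec_of_mat X = N *\<^sub>v (X *\<^sub>v x)"
    by (rule kronecker_row_mult_vec_of_mat[OF x N X])
  have "ils_Mg' J L A b *\<^sub>v vec_pair X y = append_cols (?P * ?V - ?Q) N *\<^sub>v (vec_of_mat X @\<^sub>v y)"
    unfolding ils_Mg'_def Let_def vec_pair_def K_def[symmetric] N_def[symmetric]
      x_def[symmetric] r_def[symmetric] using A by simp
  also have "\<dots> = (?P * ?V - ?Q) *\<^sub>v vec_of_mat X + N *\<^sub>v y"
    by (rule append_cols_mult_append_vec[OF minus_carrier_mat[OF Q] N vX y])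
  also have "(?P * ?V - ?Q) *\<^sub>v vec_of_mat X = K *\<^sub>v ((transpose_mat X * J) *\<^sub>v r) - N *\<^sub>v (X *\<^sub>v x)"
    using minus_mult_distrib_mat_vec[of "?P * ?V" k "m * n" ?Q] P V Q vX PV QX by simp
  also have "\<dots> + N *\<^sub>v y = K *\<^sub>v ((transpose_mat X * J) *\<^sub>v r) + N *\<^sub>v (y - X *\<^sub>v x)"
    using K XJ r N X x y mult_minus_distrib_mat_vec[OF N y, of "X *\<^sub>v x"]
    by (intro eq_vecI) auto
  also have "N *\<^sub>v (y - X *\<^sub>v x) = K *\<^sub>v ((transpose_mat A * J) *\<^sub>v (y - X *\<^sub>v x))"
    using assoc_mult_mat_vec[OF K AJ, of "y - X *\<^sub>v x"] assoc_mult_mat[of K k n "transpose_mat A" m J m]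
      K A J X x y unfolding N_def by simp
  also have "K *\<^sub>v ((transpose_mat X * J) *\<^sub>v r) + \<dots>
      = K *\<^sub>v ((transpose_mat X * J) *\<^sub>v r + (transpose_mat A * J) *\<^sub>v (y - X *\<^sub>v x))"
    using AJ XJ r X x y by (intro mult_add_distrib_mat_vec[OF K, symmetric]) auto
  finally show ?thesis unfolding x_def r_def .
qed

lemma ils_Mg'_carrier:
  assumes "A \<in> carrier_mat m n" "J \<in> carrier_mat m m" "L \<in> carrier_mat n k"
    "ils_Minv J A \<in> carrier_mat n n"
  shows "ils_Mg' J L A b \<in> carrier_mat k (n * m + m)"
  using assms by (auto simp: ils_Mg'_def Let_def append_cols_def kronecker_def ils_x_def mat_of_row_def)

section \<open>Entrywise division and the supremum over admissible perturbations\<close>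

lemma diag_vec_mult_vec:
  assumes "dim_vec w = dim_vec v"
  shows "diag_vec v *\<^sub>v w = vec (dim_vec v) (\<lambda>i. v $ i * w $ i)"
proof (rule eq_vecI)
  fix i assume "i < dim_vec (vec (dim_vec v) (\<lambda>i. v $ i * w $ i))"
  then have i: "i < dim_vec v" by simp
  have "(diag_vec v *\<^sub>v w) $ i = (\<Sum>j<dim_vec v. if i = j then v $ j * w $ j else 0)"
    using i assms
    by (subst index_mult_mat_vec_sum)
      (auto simp: diag_vec_def mat_diag_def simp del: sum.delta sum.delta' intro!: sum.cong)
  then show "(diag_vec v *\<^sub>v w) $ i = vec (dim_vec v) (\<lambda>i. v $ i * w $ i) $ i"
    using i by simp
qed (simp add: diag_vec_def mat_diag_def)

lemma diag_ddag_eq_diag_vec: "diag_ddag v = diag_vec (map_vec ddag v)"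
  by (auto simp: diag_ddag_def diag_vec_def mat_diag_def)

lemma vec_divide_eq:
  assumes "dim_vec w = dim_vec v"
  shows "vec_divide w v = vec (dim_vec v) (\<lambda>i. ddag (v $ i) * w $ i)"
  unfolding vec_divide_def diag_ddag_eq_diag_vec using assms
  by (subst diag_vec_mult_vec) auto

lemma index_scaled_mat:
  assumes "G \<in> carrier_mat k N" "\<xi> \<in> carrier_vec k" "v \<in> carrier_vec N" "i < k" "j < N"
  shows "(diag_ddag \<xi> * G * diag_vec v) $$ (i,j) = ddag (\<xi> $ i) * G $$ (i,j) * v $ j"
proof -
  have "diag_ddag \<xi> * G = mat k N (\<lambda>(i,j). ddag (\<xi> $ i) * G $$ (i,j))"
    unfolding diag_ddag_def using assms mat_diag_mult_left[OF assms(1)] by simp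
  moreover have "\<dots> * diag_vec v = mat k N (\<lambda>(i,j). ddag (\<xi> $ i) * G $$ (i,j) * v $ j)"
    unfolding diag_vec_def carrier_vecD[OF assms(3)]
    by (subst mat_diag_mult_right[of _ k N]) (auto intro!: eq_matI)
  ultimately show ?thesis using assms by simp
qed

lemma abs_ddag: "\<bar>ddag c\<bar> = ddag \<bar>c\<bar>"
  by (simp add: ddag_def)

lemma ddag_nonneg: "0 \<le> c \<Longrightarrow> 0 \<le> ddag c"
  by (simp add: ddag_def)

text \<open>Makes the denominator of the condition number the norm of a single quotient of stacked
  vectors.\<close>

lemma vec_pair_divide:
  assumes "\<Psi> \<in> carrier_mat m n" "\<beta> \<in> carrier_vec l" "X \<in> carrier_mat m n" "y \<in> carrier_vec l"
  shows "vec_pair (mat_divide X \<Psi>) (vec_divide y \<beta>) = vec_divide (vec_pair X y) (vec_pair \<Psi> \<beta>)"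
proof (rule vec_eq_vec_pairI[symmetric])
  show "mat_divide X \<Psi> \<in> carrier_mat m n" "vec_divide y \<beta> \<in> carrier_vec l"
    "vec_divide (vec_pair X y) (vec_pair \<Psi> \<beta>) \<in> carrier_vec (n * m + l)"
    using assms by (auto simp: mat_divide_def vec_divide_eq)
qed (use assms in \<open>auto simp: mat_divide_def vec_divide_eq vec_pair_index column_major_index_less trans_less_add1\<close>)

text \<open>With the constraints expressed by stacked positions, the supremum concerns one vector
  and no longer a matrix and a vector.\<close>

lemma admissible_pert_iff:
  assumes "\<Psi> \<in> carrier_mat m n" "\<beta> \<in> carrier_vec l"
  shows "(X, y) \<in> admissible_pert \<Psi> \<beta> \<longleftrightarrow>
    X \<in> carrier_mat m n \<and> y \<in> carrier_vec l \<and>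
    (\<forall>s<n * m + l. vec_pair \<Psi> \<beta> $ s = 0 \<longrightarrow> vec_pair X y $ s = 0) \<and>
    vnorm_inf (vec_divide (vec_pair X y) (vec_pair \<Psi> \<beta>)) \<noteq> 0"
proof (cases "X \<in> carrier_mat m n \<and> y \<in> carrier_vec l")
  case True
  then have Xy: "X \<in> carrier_mat m n" "y \<in> carrier_vec l" by auto
  have "(\<forall>s<n * m + l. vec_pair \<Psi> \<beta> $ s = 0 \<longrightarrow> vec_pair X y $ s = 0) \<longleftrightarrow>
    (\<forall>i<m. \<forall>j<n. \<Psi> $$ (i,j) = 0 \<longrightarrow> X $$ (i,j) = 0) \<and> (\<forall>i<l. \<beta> $ i = 0 \<longrightarrow> y $ i = 0)"
    (is "?l \<longleftrightarrow> ?r")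
  proof
    assume l: ?l
    show ?r
    proof (intro conjI allI impI)
      fix i j assume "i < m" "j < n" "\<Psi> $$ (i,j) = 0"
      then show "X $$ (i,j) = 0"
        using l[rule_format, of "j * m + i"] column_major_index_less[of i m j n]
        by (simp add: vec_pair_index[OF assms] vec_pair_index[OF Xy])
    next
      fix i assume "i < l" "\<beta> $ i = 0"
      then show "y $ i = 0"
        using l[rule_format, of "n * m + i"]
        by (simp add: vec_pair_index[OF assms] vec_pair_index[OF Xy])
    qed
  next
    assume r: ?r
    show ?l
    proof (intro allI impI)
      fix s assume "s < n * m + l" "vec_pair \<Psi> \<beta> $ s = 0"
      then show "vec_pair X y $ s = 0"
        by (cases rule: vec_pair_index_cases)
          (use r in \<open>auto simp: vec_pair_index[OF assms] vec_pair_index[OF Xy]\<close>)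
    qed
  qed
  then show ?thesis
    using assms Xy vec_pair_divide[OF assms Xy] by (auto simp: admissible_pert_def)
qed (use assms in \<open>auto simp: admissible_pert_def\<close>)

text \<open>Nothing here is special to least squares: the formula holds for every linear map
  \<open>G\<close> on stacked perturbations, because the row-sum norm is the operator norm induced
  by the max norm.\<close>

lemma SUP_admissible_pert:
  assumes G: "G \<in> carrier_mat k (n * m + l)" and \<xi>: "\<xi> \<in> carrier_vec k"
    and \<Psi>: "\<Psi> \<in> carrier_mat m n" and \<beta>: "\<beta> \<in> carrier_vec l"
  shows "(SUP (X, y) \<in> admissible_pert \<Psi> \<beta>.
        ennreal (vnorm_inf (vec_divide (G *\<^sub>v vec_pair X y) \<xi>)
                 / vnorm_inf (vec_pair (mat_divide X \<Psi>) (vec_divide y \<beta>))))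
    = ennreal (mnorm_inf (diag_ddag \<xi> * G * diag_vec (vec_pair \<Psi> \<beta>)))"
proof (rule antisym)
  define v where "v = vec_pair \<Psi> \<beta>"
  define N where "N = n * m + l"
  define B where "B = diag_ddag \<xi> * G * diag_vec v"
  have v: "v \<in> carrier_vec N" unfolding v_def N_def using \<Psi> \<beta> by simp
  have G': "G \<in> carrier_mat k N" using G N_def by simp
  have B: "B \<in> carrier_mat k N"
    unfolding B_def diag_ddag_def diag_vec_def using \<xi> v by (auto simp: mat_diag_def)
  have Bij: "B $$ (i,j) = ddag (\<xi> $ i) * G $$ (i,j) * v $ j" if "i < k" "j < N" for i j
    unfolding B_def by (rule index_scaled_mat[OF G' \<xi> v that])
  \<comment> \<open>Where \<open>v $ j\<close> is nonzero, the factor \<open>v $ j\<close> in column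
    \<open>j\<close> of \<open>B\<close> undoes the division. Where it is zero, that column of
    \<open>B\<close> and the entry \<open>u $ j\<close> both vanish, so the value 1 of
    \<open>ddag 0\<close> has no effect.\<close>
  have numer: "vec_divide (G *\<^sub>v u) \<xi> = B *\<^sub>v vec_divide u v"
    if u: "u \<in> carrier_vec N" "\<And>s. s < N \<Longrightarrow> v $ s = 0 \<Longrightarrow> u $ s = 0" for u
  proof (rule eq_vecI)
    show "dim_vec (vec_divide (G *\<^sub>v u) \<xi>) = dim_vec (B *\<^sub>v vec_divide u v)"
      using G' \<xi> B by (simp add: vec_divide_eq)
    fix i assume "i < dim_vec (B *\<^sub>v vec_divide u v)"
    then have i: "i < k" using B by simp
    have "(B *\<^sub>v vec_divide u v) $ i = (\<Sum>j<N. B $$ (i,j) * vec_divide u v $ j)"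
      using i B u v by (subst index_mult_mat_vec_sum) (auto simp: vec_divide_eq)
    also have "\<dots> = (\<Sum>j<N. ddag (\<xi> $ i) * (G $$ (i,j) * u $ j))"
    proof (intro sum.cong refl)
      fix j assume "j \<in> {..<N}"
      then show "B $$ (i,j) * vec_divide u v $ j = ddag (\<xi> $ i) * (G $$ (i,j) * u $ j)"
        using i u v Bij by (cases "v $ j = 0") (auto simp: vec_divide_eq ddag_def)
    qed
    also have "\<dots> = vec_divide (G *\<^sub>v u) \<xi> $ i"
      using i G' u \<xi> by (subst vec_divide_eq) (auto simp: index_mult_mat_vec_sum sum_distrib_left simp del: index_mult_mat_vec)
    finally show "vec_divide (G *\<^sub>v u) \<xi> $ i = (B *\<^sub>v vec_divide u v) $ i" ..
  qed
  show "(SUP (X, y) \<in> admissible_pert \<Psi> \<beta>.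
        ennreal (vnorm_inf (vec_divide (G *\<^sub>v vec_pair X y) \<xi>)
                 / vnorm_inf (vec_pair (mat_divide X \<Psi>) (vec_divide y \<beta>))))
    \<le> ennreal (mnorm_inf (diag_ddag \<xi> * G * diag_vec (vec_pair \<Psi> \<beta>)))"
    unfolding v_def[symmetric] B_def[symmetric]
  proof (rule SUP_least, clarify)
    fix X y assume "(X, y) \<in> admissible_pert \<Psi> \<beta>"
    then have X: "X \<in> carrier_mat m n" and y: "y \<in> carrier_vec l"
      and z: "\<And>s. s < N \<Longrightarrow> v $ s = 0 \<Longrightarrow> vec_pair X y $ s = 0"
      and nz: "vnorm_inf (vec_divide (vec_pair X y) v) \<noteq> 0"
      unfolding admissible_pert_iff[OF \<Psi> \<beta>] v_def N_def by auto
    have u: "vec_pair X y \<in> carrier_vec N" using X y N_def by simp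
    have nu: "vec_divide (G *\<^sub>v vec_pair X y) \<xi> = B *\<^sub>v vec_divide (vec_pair X y) v"
      by (rule numer[OF u]) (use z in auto)
    have "vnorm_inf (B *\<^sub>v vec_divide (vec_pair X y) v)
        \<le> mnorm_inf B * vnorm_inf (vec_divide (vec_pair X y) v)"
      using carrier_matD[OF B] carrier_vecD[OF u] carrier_vecD[OF v]
      by (intro vnorm_inf_mult_mat_vec) (simp add: vec_divide_eq del: dim_vec_pair)
    moreover have "vnorm_inf (vec_divide (vec_pair X y) v) > 0"
      using nz vnorm_inf_nonneg[of "vec_divide (vec_pair X y) v"] by linarith
    ultimately show "ennreal (vnorm_inf (vec_divide (G *\<^sub>v vec_pair X y) \<xi>)
          / vnorm_inf (vec_pair (mat_divide X \<Psi>) (vec_divide y \<beta>))) \<le> ennreal (mnorm_inf B)"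
      unfolding vec_pair_divide[OF \<Psi> \<beta> X y] v_def[symmetric] nu
      by (intro ennreal_leI) (simp add: divide_le_eq)
  qed
  show "ennreal (mnorm_inf (diag_ddag \<xi> * G * diag_vec (vec_pair \<Psi> \<beta>)))
    \<le> (SUP (X, y) \<in> admissible_pert \<Psi> \<beta>.
        ennreal (vnorm_inf (vec_divide (G *\<^sub>v vec_pair X y) \<xi>)
                 / vnorm_inf (vec_pair (mat_divide X \<Psi>) (vec_divide y \<beta>))))"
    unfolding v_def[symmetric] B_def[symmetric]
  proof (cases "mnorm_inf B = 0")
    \<comment> \<open>The case of norm 0 is immediate, since 0 is below every supremum, even one
      over no perturbations at all.\<close>
    case False
    then obtain i where i: "i < k" and max: "mnorm_inf B = (\<Sum>j<N. \<bar>B $$ (i,j)\<bar>)"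
      using mnorm_inf_attained[of B] B by auto
    \<comment> \<open>The bound is attained at the scaled perturbation with the sign pattern of a maximal row.\<close>
    define w where "w = vec N (\<lambda>j. sgn (B $$ (i,j)))"
    define u where "u = vec N (\<lambda>j. v $ j * w $ j)"
    have w: "w \<in> carrier_vec N" and u: "u \<in> carrier_vec N" unfolding w_def u_def by simp_all
    have uz: "\<And>s. s < N \<Longrightarrow> v $ s = 0 \<Longrightarrow> u $ s = 0" unfolding u_def by simp
    have nu: "vec_divide (G *\<^sub>v u) \<xi> = B *\<^sub>v vec_divide u v"
      by (rule numer[OF u]) (use uz in auto)
    have uv: "vec_divide u v = w"
      using u v w i by (intro eq_vecI) (auto simp: vec_divide_eq u_def w_def Bij ddag_def)
    have le1: "vnorm_inf w \<le> 1"
      by (subst vnorm_inf_le_iff) (auto simp: w_def abs_sgn_eq)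
    have "(B *\<^sub>v w) $ i = (\<Sum>j<N. B $$ (i,j) * w $ j)"
      using B i w by (subst index_mult_mat_vec_sum) auto
    also have "\<dots> = mnorm_inf B"
      unfolding max w_def by (intro sum.cong) (auto simp: abs_sgn)
    finally have ge: "mnorm_inf B \<le> vnorm_inf (B *\<^sub>v w)"
      using abs_index_le_vnorm_inf[of i "B *\<^sub>v w"] B i by simp
    moreover have "vnorm_inf (B *\<^sub>v w) \<le> mnorm_inf B * vnorm_inf w"
      using B w by (intro vnorm_inf_mult_mat_vec) simp
    ultimately have "mnorm_inf B \<le> mnorm_inf B * vnorm_inf w" by (rule order_trans)
    \<comment> \<open>Admissibility requires a nonzero quotient: if \<open>w\<close> had norm 0, the
      inequality just derived would force \<open>mnorm_inf B\<close> to be 0.\<close>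
    then have nz: "vnorm_inf w \<noteq> 0"
      using False mnorm_inf_nonneg[of B] by force
    obtain X y where X: "X \<in> carrier_mat m n" and y: "y \<in> carrier_vec l" and Xy: "vec_pair X y = u"
      using vec_pair_surj u unfolding N_def by metis
    have adm: "(X, y) \<in> admissible_pert \<Psi> \<beta>"
      unfolding admissible_pert_iff[OF \<Psi> \<beta>] Xy v_def[symmetric] N_def[symmetric] uv
      using X y uz nz by auto
    have "mnorm_inf B \<le> vnorm_inf (B *\<^sub>v w) / vnorm_inf w"
    proof -
      have "mnorm_inf B * vnorm_inf w \<le> mnorm_inf B * 1"
        by (intro mult_left_mono le1) simp
      moreover have "vnorm_inf w > 0" using nz vnorm_inf_nonneg[of w] by linarith
      ultimately show ?thesis using ge by (simp add: pos_le_divide_eq)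
    qed
    also have "\<dots> = vnorm_inf (vec_divide (G *\<^sub>v vec_pair X y) \<xi>)
          / vnorm_inf (vec_pair (mat_divide X \<Psi>) (vec_divide y \<beta>))"
      unfolding vec_pair_divide[OF \<Psi> \<beta> X y] v_def[symmetric] Xy nu uv ..
    finally show "ennreal (mnorm_inf B) \<le> (SUP (X, y) \<in> admissible_pert \<Psi> \<beta>.
        ennreal (vnorm_inf (vec_divide (G *\<^sub>v vec_pair X y) \<xi>)
                 / vnorm_inf (vec_pair (mat_divide X \<Psi>) (vec_divide y \<beta>))))"
      by (intro SUP_upper2[OF adm]) (simp add: ennreal_leI)
  qed simp
qed

text \<open>Since |ddag c| = ddag |c|, the absolute row sum of the scaled matrix factors into the
  corresponding entry of the quotient vector; both maxima range over the same numbers.\<close>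

lemma mnorm_inf_eq_vnorm_inf_abs:
  assumes G: "G \<in> carrier_mat k N" and \<xi>: "\<xi> \<in> carrier_vec k" and v: "v \<in> carrier_vec N"
  shows "mnorm_inf (diag_ddag \<xi> * G * diag_vec v) = vnorm_inf (vec_divide (mabs G *\<^sub>v vabs v) (vabs \<xi>))"
proof -
  let ?B = "diag_ddag \<xi> * G * diag_vec v" and ?w = "vec_divide (mabs G *\<^sub>v vabs v) (vabs \<xi>)"
  have B: "?B \<in> carrier_mat k N"
    unfolding diag_ddag_def diag_vec_def using \<xi> v by (auto simp: mat_diag_def)
  have w: "dim_vec ?w = k" using G \<xi> by (simp add: vec_divide_eq)
  have eq: "(\<Sum>j<N. \<bar>?B $$ (i,j)\<bar>) = \<bar>?w $ i\<bar>" if i: "i < k" for i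
  proof -
    have "?w $ i = ddag \<bar>\<xi> $ i\<bar> * (\<Sum>j<N. \<bar>G $$ (i,j)\<bar> * \<bar>v $ j\<bar>)"
      using i G \<xi> v by (subst vec_divide_eq) (auto simp: index_mult_mat_vec_sum simp del: index_mult_mat_vec)
    also have "\<dots> = (\<Sum>j<N. \<bar>?B $$ (i,j)\<bar>)"
      using i by (auto simp: sum_distrib_left index_scaled_mat[OF G \<xi> v] abs_mult abs_ddag mult.assoc intro!: sum.cong)
    finally show ?thesis by (simp add: sum_nonneg)
  qed
  have "{\<Sum>j<dim_col ?B. \<bar>?B $$ (i,j)\<bar> | i. i < dim_row ?B} = (\<lambda>i. \<Sum>j<N. \<bar>?B $$ (i,j)\<bar>) ` {..<k}"
    unfolding carrier_matD[OF B] by blast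
  also have "\<dots> = (\<lambda>i. \<bar>?w $ i\<bar>) ` {..<k}"
    using eq by (intro image_cong) auto
  also have "\<dots> = {\<bar>?w $ i\<bar> | i. i < dim_vec ?w}"
    unfolding w by auto
  finally show ?thesis unfolding mnorm_inf_def vnorm_inf_def by simp
qed

text \<open>Division by a constant vector is multiplication by the nonnegative scalar
  \<open>ddag c\<close>. This also covers \<open>c = 0\<close>, where both sides divide by 1, as
  happens for the mixed condition number when L^T x = 0.\<close>

lemma vnorm_inf_vec_divide_const:
  assumes "0 \<le> c" "w \<in> carrier_vec k"
  shows "vnorm_inf (vec_divide w (vabs (vec k (\<lambda>_. c)))) = scalar_divide (vnorm_inf w) c"
proof -
  have "vec_divide w (vabs (vec k (\<lambda>_. c))) = ddag c \<cdot>\<^sub>v w"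
    using assms by (intro eq_vecI) (auto simp: vec_divide_eq)
  then show ?thesis
    using ddag_nonneg[OF assms(1)] by (simp add: vnorm_inf_smult scalar_divide_def)
qed

section \<open>Uniqueness of the Frechet derivative\<close>

lemma has_frechet_derivativeD:
  assumes "has_frechet_derivative f D A b"
  shows "X \<in> carrier_mat (dim_row A) (dim_col A) \<Longrightarrow> y \<in> carrier_vec (dim_vec b) \<Longrightarrow>
      D X y \<in> carrier_vec (dim_vec (f A b))"
    and "X \<in> carrier_mat (dim_row A) (dim_col A) \<Longrightarrow> y \<in> carrier_vec (dim_vec b) \<Longrightarrow>
      D (c \<cdot>\<^sub>m X) (c \<cdot>\<^sub>v y) = c \<cdot>\<^sub>v D X y"
    and "e > 0 \<Longrightarrow> \<exists>d>0. \<forall>X\<in>carrier_mat (dim_row A) (dim_col A). \<forall>y\<in>carrier_vec (dim_vec b).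
      vnorm_inf (vec_pair X y) < d \<longrightarrow>
      vnorm_inf (f (A + X) (b + y) - f A b - D X y) \<le> e * vnorm_inf (vec_pair X y)"
  using assms unfolding has_frechet_derivative_def Let_def by simp_all

text \<open>Scaling the perturbation by a small \<open>t\<close> scales the difference of the two
  linear maps by \<open>t\<close>, while the approximation errors are at most an arbitrarily small
  multiple of \<open>t\<close>. Dividing by \<open>t\<close> leaves only the value 0 for the
  difference.\<close>

lemma has_frechet_derivative_unique:
  assumes D: "has_frechet_derivative f D A b" and D': "has_frechet_derivative f D' A b"
    and X: "X \<in> carrier_mat (dim_row A) (dim_col A)" and y: "y \<in> carrier_vec (dim_vec b)"
  shows "D X y = D' X y"
proof -
  define k where "k = dim_vec (f A b)"
  define h where "h = vnorm_inf (vec_pair X y)"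
  define \<delta> where "\<delta> = vnorm_inf (D X y - D' X y)"
  have h0: "0 \<le> h" unfolding h_def by simp
  have c: "D X y \<in> carrier_vec k" "D' X y \<in> carrier_vec k"
    and sm: "\<And>c. D (c \<cdot>\<^sub>m X) (c \<cdot>\<^sub>v y) = c \<cdot>\<^sub>v D X y" "\<And>c. D' (c \<cdot>\<^sub>m X) (c \<cdot>\<^sub>v y) = c \<cdot>\<^sub>v D' X y"
    unfolding k_def using has_frechet_derivativeD(1,2)[OF D X y] has_frechet_derivativeD(1,2)[OF D' X y]
    by auto
  have "\<delta> \<le> 0 + e" if e: "e > 0" for e
  proof -
    \<comment> \<open>Two errors, each at most \<open>e' * (t * h)\<close>, have to add up to at
      most \<open>e * t\<close>. The denominator uses \<open>h + 1\<close> because \<open>h\<close>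
      may be 0.\<close>
    define e' where "e' = e / (2 * (h + 1))"
    have e': "e' > 0" unfolding e'_def using e h0 by simp
    obtain d where d: "d > 0" "\<And>X y. X \<in> carrier_mat (dim_row A) (dim_col A) \<Longrightarrow> y \<in> carrier_vec (dim_vec b) \<Longrightarrow>
        vnorm_inf (vec_pair X y) < d \<Longrightarrow>
        vnorm_inf (f (A + X) (b + y) - f A b - D X y) \<le> e' * vnorm_inf (vec_pair X y)"
      using has_frechet_derivativeD(3)[OF D e'] by blast
    obtain d' where d': "d' > 0" "\<And>X y. X \<in> carrier_mat (dim_row A) (dim_col A) \<Longrightarrow> y \<in> carrier_vec (dim_vec b) \<Longrightarrow>
        vnorm_inf (vec_pair X y) < d' \<Longrightarrow>
        vnorm_inf (f (A + X) (b + y) - f A b - D' X y) \<le> e' * vnorm_inf (vec_pair X y)"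
      using has_frechet_derivativeD(3)[OF D' e'] by blast
    \<comment> \<open>Chosen so that the scaled perturbation, of size \<open>t * h\<close>, lies
      within both radii.\<close>
    define t where "t = min d d' / (h + 1)"
    have t: "t > 0" unfolding t_def using d d' h0 by simp
    have "t * h < t * (h + 1)" using t by simp
    also have "\<dots> = min d d'" unfolding t_def using h0 by simp
    finally have th: "t * h < d" "t * h < d'" by auto
    let ?X = "t \<cdot>\<^sub>m X" and ?y = "t \<cdot>\<^sub>v y"
    have X': "?X \<in> carrier_mat (dim_row A) (dim_col A)" "?y \<in> carrier_vec (dim_vec b)"
      using X y by auto
    have n: "vnorm_inf (vec_pair ?X ?y) = t * h"
      using vec_pair_smult[OF X y] t by (simp add: vnorm_inf_smult h_def)
    define w where "w = f (A + ?X) (b + ?y) - f A b"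
    have w: "dim_vec w = k" unfolding w_def k_def by simp
    have "t * \<delta> = vnorm_inf (t \<cdot>\<^sub>v (D X y - D' X y))"
      using t by (simp add: vnorm_inf_smult \<delta>_def)
    \<comment> \<open>The common increment \<open>w\<close> cancels, so the difference of the
      candidates is a difference of two approximation errors.\<close>
    also have "t \<cdot>\<^sub>v (D X y - D' X y) = (w - D' ?X ?y) - (w - D ?X ?y)"
      using c w by (intro eq_vecI) (auto simp: sm algebra_simps)
    also have "vnorm_inf \<dots> \<le> vnorm_inf (w - D' ?X ?y) + vnorm_inf (w - D ?X ?y)"
      using c by (intro vnorm_inf_diff[of _ k] carrier_vecI) (simp_all add: sm)
    also have "\<dots> \<le> e' * (t * h) + e' * (t * h)"
      using d(2)[OF X'] d'(2)[OF X'] th unfolding n w_def[symmetric] by (intro add_mono) auto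
    finally have "t * \<delta> \<le> t * (2 * e' * h)" by (simp add: algebra_simps)
    then have "\<delta> \<le> 2 * e' * h" using t by simp
    also have "\<dots> \<le> e"
      unfolding e'_def using e h0 by (simp add: field_simps)
    finally show ?thesis by simp
  qed
  then have "\<delta> \<le> 0" by (rule field_le_epsilon)
  then have "vnorm_inf (D X y - D' X y) = 0" unfolding \<delta>_def using vnorm_inf_nonneg by (metis antisym)
  then have z: "D X y - D' X y = 0\<^sub>v k" using c by (simp add: vnorm_inf_zero_iff)
  show ?thesis
  proof (rule eq_vecI)
    fix i assume "i < dim_vec (D' X y)"
    then show "D X y $ i = D' X y $ i" using c arg_cong[OF z, of "\<lambda>v. v $ i"] by simp
  qed (use c in simp)
qed

lemma frechet_deriv_eq:
  assumes "has_frechet_derivative f D A b"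
    and "X \<in> carrier_mat (dim_row A) (dim_col A)" "y \<in> carrier_vec (dim_vec b)"
  shows "frechet_deriv f A b X y = D X y"
  unfolding frechet_deriv_def
  by (rule has_frechet_derivative_unique[OF someI[of "\<lambda>D. has_frechet_derivative f D A b"]])
    (use assms in auto)

section \<open>Nonsingularity and the normal equations\<close>

text \<open>A trivial kernel gives a nonzero determinant, hence a unit of the matrix ring, so
  \<open>mat_inverse\<close> returns \<open>Some\<close>. The kernel condition is the form in which
  nonsingularity is obtained for the perturbed matrix as well.\<close>

lemma mat_inverse_nonsingular:
  fixes M :: "'a::field mat"
  assumes M: "M \<in> carrier_mat n n"
    and inj: "\<forall>v\<in>carrier_vec n. M *\<^sub>v v = 0\<^sub>v n \<longrightarrow> v = 0\<^sub>v n"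
  shows "the (mat_inverse M) \<in> carrier_mat n n" "M * the (mat_inverse M) = 1\<^sub>m n"
    "the (mat_inverse M) * M = 1\<^sub>m n"
proof -
  have "det M \<noteq> 0" using det_0_iff_vec_prod_zero_field[OF M] inj by blast
  then have "M \<in> Units (ring_mat TYPE('a) n ())" by (rule det_non_zero_imp_unit[OF M])
  then obtain B where "mat_inverse M = Some B"
    using mat_inverse(1)[OF M, where b = "()"] by (cases "mat_inverse M") auto
  then show "the (mat_inverse M) \<in> carrier_mat n n" "M * the (mat_inverse M) = 1\<^sub>m n"
    "the (mat_inverse M) * M = 1\<^sub>m n"
    using mat_inverse(2)[OF M] by auto
qed

lemma pos_def_mat_nonsingular:
  assumes "pos_def_mat M" "M \<in> carrier_mat n n"
  shows "\<forall>v\<in>carrier_vec n. M *\<^sub>v v = 0\<^sub>v n \<longrightarrow> v = 0\<^sub>v n"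
proof (intro ballI impI)
  fix v assume v: "v \<in> carrier_vec n" and Mv: "M *\<^sub>v v = 0\<^sub>v n"
  have "\<not> v \<bullet> (M *\<^sub>v v) > 0" using v Mv by simp
  then show "v = 0\<^sub>v n" using assms v unfolding pos_def_mat_def by auto
qed

context
  fixes A J :: "real mat" and m n :: nat
  assumes A: "A \<in> carrier_mat m n" and J: "J \<in> carrier_mat m m"
begin

lemma ils_M_carrier: "ils_M J A \<in> carrier_mat n n"
  unfolding ils_M_def using A J by simp

lemma ils_M_mult_vec:
  assumes "v \<in> carrier_vec n"
  shows "ils_M J A *\<^sub>v v = (transpose_mat A * J) *\<^sub>v (A *\<^sub>v v)"
  unfolding ils_M_def by (rule assoc_mult_mat_vec[of _ n m _ n]) (use A J assms in auto)

context
  assumes nonsing: "\<forall>v\<in>carrier_vec n. ils_M J A *\<^sub>v v = 0\<^sub>v n \<longrightarrow> v = 0\<^sub>v n"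
begin

lemmas ils_Minv = mat_inverse_nonsingular[OF ils_M_carrier nonsing, folded ils_Minv_def]

lemma ils_x_carrier: "b \<in> carrier_vec m \<Longrightarrow> ils_x J A b \<in> carrier_vec n"
  unfolding ils_x_def using ils_Minv(1) A J
  by (intro mult_mat_vec_carrier[of _ n m] mult_carrier_mat[of _ n m] mult_carrier_mat[of _ n n]) auto

lemma ils_r_carrier: "b \<in> carrier_vec m \<Longrightarrow> ils_r J A b \<in> carrier_vec m"
  unfolding ils_r_def using ils_x_carrier A by simp

text \<open>Multiplying the formula for x by M gives A^T J A x = A^T J b, so the residual is
  J-orthogonal to the columns of A.\<close>

lemma ils_normal_equation:
  assumes b: "b \<in> carrier_vec m"
  shows "(transpose_mat A * J) *\<^sub>v ils_r J A b = 0\<^sub>v n"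
proof -
  have H: "transpose_mat A * J \<in> carrier_mat n m" using A J by simp
  have "ils_x J A b = (ils_Minv J A * (transpose_mat A * J)) *\<^sub>v b"
    unfolding ils_x_def using ils_Minv(1) A J by (simp add: assoc_mult_mat[of _ n n _ m _ m])
  then have "ils_x J A b = ils_Minv J A *\<^sub>v ((transpose_mat A * J) *\<^sub>v b)"
    using assoc_mult_mat_vec[OF ils_Minv(1) H b] by simp
  then have "ils_M J A *\<^sub>v ils_x J A b = (ils_M J A * ils_Minv J A) *\<^sub>v ((transpose_mat A * J) *\<^sub>v b)"
    using assoc_mult_mat_vec[OF ils_M_carrier ils_Minv(1)] H b by simp
  then have "(transpose_mat A * J) *\<^sub>v (A *\<^sub>v ils_x J A b) = (transpose_mat A * J) *\<^sub>v b"
    using ils_Minv(2) H b ils_M_mult_vec[OF ils_x_carrier[OF b]] by simp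
  then show ?thesis
    unfolding ils_r_def using mult_minus_distrib_mat_vec[OF H b, of "A *\<^sub>v ils_x J A b"]
      A ils_x_carrier[OF b] H b by simp
qed

end

end

section \<open>Perturbation of M and of the solution\<close>

text \<open>The change of M applied to a vector: what (A + X)^T J (A + X) v contains beyond A^T J A
  v. Written with matrix-vector products, it can be bounded summand by summand.\<close>

definition ils_M_diff :: "real mat \<Rightarrow> real mat \<Rightarrow> real mat \<Rightarrow> real vec \<Rightarrow> real vec" where
  "ils_M_diff J A X v = (transpose_mat A * J) *\<^sub>v (X *\<^sub>v v)
     + (transpose_mat X * J) *\<^sub>v (A *\<^sub>v v) + (transpose_mat X * J) *\<^sub>v (X *\<^sub>v v)"

lemma transpose_mult_add_mult_vec:
  fixes A X J :: "real mat"
  assumes "A \<in> carrier_mat m n" "X \<in> carrier_mat m n" "J \<in> carrier_mat m m" "w \<in> carrier_vec m"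
  shows "(transpose_mat (A + X) * J) *\<^sub>v w = (transpose_mat A * J) *\<^sub>v w + (transpose_mat X * J) *\<^sub>v w"
proof -
  have "transpose_mat (A + X) * J = transpose_mat A * J + transpose_mat X * J"
    using assms by (simp add: transpose_add add_mult_distrib_mat[of _ n m])
  then show ?thesis
    using assms by (simp add: add_mult_distrib_mat_vec[of _ n m])
qed

lemma ils_M_add_mult_vec:
  assumes A: "A \<in> carrier_mat m n" and X: "X \<in> carrier_mat m n" and J: "J \<in> carrier_mat m m"
    and v: "v \<in> carrier_vec n"
  shows "ils_M J (A + X) *\<^sub>v v = ils_M J A *\<^sub>v v + ils_M_diff J A X v"
proof -
  let ?H = "transpose_mat A * J" and ?G = "transpose_mat X * J"
  have H: "?H \<in> carrier_mat n m" and G: "?G \<in> carrier_mat n m" using A X J by auto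
  have Av: "A *\<^sub>v v \<in> carrier_vec m" and Xv: "X *\<^sub>v v \<in> carrier_vec m" using A X v by auto
  have AX: "A + X \<in> carrier_mat m n" using A X by simp
  have "ils_M J (A + X) *\<^sub>v v = (transpose_mat (A + X) * J) *\<^sub>v (A *\<^sub>v v + X *\<^sub>v v)"
    using ils_M_mult_vec[OF AX J v] add_mult_distrib_mat_vec[OF A X v] by simp
  also have "\<dots> = ?H *\<^sub>v (A *\<^sub>v v + X *\<^sub>v v) + ?G *\<^sub>v (A *\<^sub>v v + X *\<^sub>v v)"
    using Av Xv by (intro transpose_mult_add_mult_vec[OF A X J]) simp
  also have "\<dots> = ?H *\<^sub>v (A *\<^sub>v v) + ils_M_diff J A X v"
    unfolding ils_M_diff_def mult_add_distrib_mat_vec[OF H Av Xv] mult_add_distrib_mat_vec[OF G Av Xv]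
    using mult_mat_vec_carrier[OF H Av] mult_mat_vec_carrier[OF H Xv]
      mult_mat_vec_carrier[OF G Av] mult_mat_vec_carrier[OF G Xv]
    by (intro eq_vecI) (simp_all del: index_mult_mat_vec)
  finally show ?thesis using ils_M_mult_vec[OF A J v] by simp
qed

lemma vnorm_inf_transpose_mult:
  assumes X: "X \<in> carrier_mat m n" and J: "J \<in> carrier_mat m m" and w: "w \<in> carrier_vec m"
    and h: "mnorm_inf (transpose_mat X) \<le> c"
  shows "vnorm_inf ((transpose_mat X * J) *\<^sub>v w) \<le> c * mnorm_inf J * vnorm_inf w"
proof -
  have "(transpose_mat X * J) *\<^sub>v w = transpose_mat X *\<^sub>v (J *\<^sub>v w)"
    using X J w by (intro assoc_mult_mat_vec[of _ n m]) auto
  also have "vnorm_inf \<dots> \<le> mnorm_inf (transpose_mat X) * vnorm_inf (J *\<^sub>v w)"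
    using X J by (intro vnorm_inf_mult_mat_vec) simp
  also have "\<dots> \<le> c * (mnorm_inf J * vnorm_inf w)"
    using J w h by (intro mult_mono vnorm_inf_mult_mat_vec) (auto intro: order_trans[OF _ h])
  finally show ?thesis by (simp add: mult.assoc)
qed

text \<open>The three constants belong to the three summands in order. The quadratic summand carries
  \<open>h * h\<close>, and \<open>h \<le> 1\<close> reduces this to \<open>h\<close>, so that a
  single bound linear in \<open>h\<close> can be absorbed later.\<close>

lemma vnorm_inf_ils_M_diff:
  assumes A: "A \<in> carrier_mat m n" and X: "X \<in> carrier_mat m n" and J: "J \<in> carrier_mat m m"
    and v: "v \<in> carrier_vec n"
    and hX: "mnorm_inf X \<le> n * h" and hXt: "mnorm_inf (transpose_mat X) \<le> m * h"
    and h: "0 \<le> h" "h \<le> 1"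
  shows "vnorm_inf (ils_M_diff J A X v)
    \<le> (mnorm_inf (transpose_mat A * J) * n + m * mnorm_inf J * mnorm_inf A + m * mnorm_inf J * n)
      * h * vnorm_inf v"
proof -
  let ?H = "transpose_mat A * J" and ?G = "transpose_mat X * J"
  let ?a = "mnorm_inf A" and ?j = "mnorm_inf J" and ?v = "vnorm_inf v"
  have H: "?H \<in> carrier_mat n m" and G: "?G \<in> carrier_mat n m" using A X J by auto
  have Av: "A *\<^sub>v v \<in> carrier_vec m" and Xv: "X *\<^sub>v v \<in> carrier_vec m" using A X v by auto
  have "vnorm_inf (X *\<^sub>v v) \<le> mnorm_inf X * ?v"
    using X v by (intro vnorm_inf_mult_mat_vec) simp
  also have "\<dots> \<le> n * h * ?v" by (intro mult_right_mono hX) simp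
  finally have nXv: "vnorm_inf (X *\<^sub>v v) \<le> n * h * ?v" .
  have nAv: "vnorm_inf (A *\<^sub>v v) \<le> ?a * ?v"
    using A v by (intro vnorm_inf_mult_mat_vec) simp
  have "vnorm_inf (?H *\<^sub>v (X *\<^sub>v v)) \<le> mnorm_inf ?H * vnorm_inf (X *\<^sub>v v)"
    by (rule vnorm_inf_mult_mat_vec) (use carrier_matD[OF H] carrier_vecD[OF Xv] in simp)
  also have "\<dots> \<le> mnorm_inf ?H * (n * h * ?v)" by (intro mult_left_mono nXv) simp
  finally have 1: "vnorm_inf (?H *\<^sub>v (X *\<^sub>v v)) \<le> mnorm_inf ?H * (n * h * ?v)" .
  have "vnorm_inf (?G *\<^sub>v (A *\<^sub>v v)) \<le> m * h * ?j * vnorm_inf (A *\<^sub>v v)"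
    by (rule vnorm_inf_transpose_mult[OF X J Av hXt])
  also have "\<dots> \<le> m * h * ?j * (?a * ?v)" using h by (intro mult_left_mono nAv) simp
  finally have 2: "vnorm_inf (?G *\<^sub>v (A *\<^sub>v v)) \<le> m * h * ?j * (?a * ?v)" .
  have "vnorm_inf (?G *\<^sub>v (X *\<^sub>v v)) \<le> m * h * ?j * vnorm_inf (X *\<^sub>v v)"
    by (rule vnorm_inf_transpose_mult[OF X J Xv hXt])
  also have "\<dots> \<le> m * h * ?j * (n * h * ?v)" using h by (intro mult_left_mono nXv) simp
  also have "\<dots> = (m * ?j * n * h * ?v) * h" by (simp add: mult_ac)
  also have "\<dots> \<le> (m * ?j * n * h * ?v) * 1" using h by (intro mult_left_mono) simp_all
  finally have 3: "vnorm_inf (?G *\<^sub>v (X *\<^sub>v v)) \<le> m * ?j * n * h * ?v" by simp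
  have c: "?H *\<^sub>v (X *\<^sub>v v) \<in> carrier_vec n" "?G *\<^sub>v (A *\<^sub>v v) \<in> carrier_vec n"
    "?G *\<^sub>v (X *\<^sub>v v) \<in> carrier_vec n"
    using mult_mat_vec_carrier[OF H Xv] mult_mat_vec_carrier[OF G Av] mult_mat_vec_carrier[OF G Xv] .
  have "vnorm_inf (ils_M_diff J A X v) \<le> vnorm_inf (?H *\<^sub>v (X *\<^sub>v v))
      + vnorm_inf (?G *\<^sub>v (A *\<^sub>v v)) + vnorm_inf (?G *\<^sub>v (X *\<^sub>v v))"
    unfolding ils_M_diff_def
    using vnorm_inf_add[OF add_carrier_vec[OF c(1,2)] c(3)] vnorm_inf_add[OF c(1,2)] by linarith
  then show ?thesis using 1 2 3 by (simp add: algebra_simps)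
qed

lemma ils_M_diff_carrier:
  assumes "A \<in> carrier_mat m n" "X \<in> carrier_mat m n" "J \<in> carrier_mat m m"
  shows "ils_M_diff J A X v \<in> carrier_vec n"
  using assms by (intro carrier_vecI) (simp add: ils_M_diff_def)

text \<open>Subtracting the normal equations of the two problems leaves a linear equation for the
  change \<open>z\<close> of the solution, whose first summand is linear in the perturbation.\<close>

lemma ils_M_mult_solution_diff:
  fixes A X J :: "real mat" and b y :: "real vec"
  defines "r \<equiv> ils_r J A b"
    and "u \<equiv> y - X *\<^sub>v ils_x J A b"
    and "z \<equiv> ils_x J (A + X) (b + y) - ils_x J A b"
  assumes A: "A \<in> carrier_mat m n" and X: "X \<in> carrier_mat m n" and J: "J \<in> carrier_mat m m"
    and b: "b \<in> carrier_vec m" and y: "y \<in> carrier_vec m"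
    and nonsing: "\<forall>v\<in>carrier_vec n. ils_M J A *\<^sub>v v = 0\<^sub>v n \<longrightarrow> v = 0\<^sub>v n"
    and nonsing': "\<forall>v\<in>carrier_vec n. ils_M J (A + X) *\<^sub>v v = 0\<^sub>v n \<longrightarrow> v = 0\<^sub>v n"
  shows "ils_M J A *\<^sub>v z = ((transpose_mat X * J) *\<^sub>v r + (transpose_mat A * J) *\<^sub>v u)
    + ((transpose_mat X * J) *\<^sub>v u - ils_M_diff J A X z)"
proof -
  let ?H = "transpose_mat A * J" and ?G = "transpose_mat X * J"
  have AX: "A + X \<in> carrier_mat m n" using A X by simp
  have by': "b + y \<in> carrier_vec m" using b y by simp
  have H: "?H \<in> carrier_mat n m" and G: "?G \<in> carrier_mat n m" using A X J by auto
  define x where "x = ils_x J A b"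
  define x' where "x' = ils_x J (A + X) (b + y)"
  have x: "x \<in> carrier_vec n" unfolding x_def by (rule ils_x_carrier[OF A J nonsing b])
  have x': "x' \<in> carrier_vec n" unfolding x'_def by (rule ils_x_carrier[OF AX J nonsing' by'])
  have r: "r \<in> carrier_vec m" unfolding r_def by (rule ils_r_carrier[OF A J nonsing b])
  have u: "u \<in> carrier_vec m" unfolding u_def using X x y x_def by simp
  have z: "z \<in> carrier_vec n" unfolding z_def x_def[symmetric] x'_def[symmetric] using x x' by simp
  have Az: "A *\<^sub>v z \<in> carrier_vec m" and Xz: "X *\<^sub>v z \<in> carrier_vec m" using A X z by auto
  have zd: "z = x' - x" unfolding z_def x_def x'_def ..
  have cs: "A *\<^sub>v x \<in> carrier_vec m" "X *\<^sub>v x \<in> carrier_vec m"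
    "A *\<^sub>v x' \<in> carrier_vec m" "X *\<^sub>v x' \<in> carrier_vec m" using A X x x' by auto
  \<comment> \<open>With x' = x + z this is b + y - (A + X)(x + z), regrouped as r = b - A x, u = y
    - X x and the terms in z.\<close>
  have r': "ils_r J (A + X) (b + y) = (r + u) - (A *\<^sub>v z + X *\<^sub>v z)" (is "?r' = ?s - ?t")
    unfolding ils_r_def r_def u_def zd x_def[symmetric] x'_def[symmetric]
      mult_minus_distrib_mat_vec[OF A x' x] mult_minus_distrib_mat_vec[OF X x' x]
      add_mult_distrib_mat_vec[OF A X x']
    using carrier_vecD[OF b] carrier_vecD[OF y] carrier_matD[OF A] carrier_matD[OF X]
    by (intro eq_vecI) (simp_all del: index_mult_mat_vec)
  have s: "?s \<in> carrier_vec m" and t: "?t \<in> carrier_vec m" using r u Az Xz by auto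
  have "(transpose_mat (A + X) * J) *\<^sub>v ?r' = 0\<^sub>v n"
    by (rule ils_normal_equation[OF AX J nonsing' by'])
  then have "?H *\<^sub>v (?s - ?t) + ?G *\<^sub>v (?s - ?t) = 0\<^sub>v n"
    unfolding r' using s t by (subst (asm) transpose_mult_add_mult_vec[OF A X J]) auto
  \<comment> \<open>The one summand free of \<open>X\<close>, \<open>y\<close> and \<open>z\<close>
    drops out by the unperturbed normal equation. Folding
    \<open>?H *\<^sub>v (A *\<^sub>v z)\<close> into M z then allows solving for M z.\<close>
  moreover have "?H *\<^sub>v r = 0\<^sub>v n"
    unfolding r_def by (rule ils_normal_equation[OF A J nonsing b])
  ultimately have eq: "(0\<^sub>v n + ?H *\<^sub>v u - (ils_M J A *\<^sub>v z + ?H *\<^sub>v (X *\<^sub>v z)))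
      + (?G *\<^sub>v r + ?G *\<^sub>v u - (?G *\<^sub>v (A *\<^sub>v z) + ?G *\<^sub>v (X *\<^sub>v z))) = 0\<^sub>v n"
    by (simp only: mult_minus_distrib_mat_vec[OF H s t] mult_minus_distrib_mat_vec[OF G s t]
      mult_add_distrib_mat_vec[OF H r u] mult_add_distrib_mat_vec[OF G r u]
      mult_add_distrib_mat_vec[OF H Az Xz] mult_add_distrib_mat_vec[OF G Az Xz]
      ils_M_mult_vec[OF A J z])
  have c: "?H *\<^sub>v u \<in> carrier_vec n" "ils_M J A *\<^sub>v z \<in> carrier_vec n" "?H *\<^sub>v (X *\<^sub>v z) \<in> carrier_vec n"
    "?G *\<^sub>v r \<in> carrier_vec n" "?G *\<^sub>v u \<in> carrier_vec n" "?G *\<^sub>v (A *\<^sub>v z) \<in> carrier_vec n"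
    "?G *\<^sub>v (X *\<^sub>v z) \<in> carrier_vec n"
    by (rule mult_mat_vec_carrier[OF H u] mult_mat_vec_carrier[OF ils_M_carrier[OF A J] z]
      mult_mat_vec_carrier[OF H Xz] mult_mat_vec_carrier[OF G r] mult_mat_vec_carrier[OF G u]
      mult_mat_vec_carrier[OF G Az] mult_mat_vec_carrier[OF G Xz])+
  show ?thesis unfolding ils_M_diff_def
  proof (rule eq_vecI)
    fix i assume "i < dim_vec ((?G *\<^sub>v r + ?H *\<^sub>v u) + (?G *\<^sub>v u
      - (?H *\<^sub>v (X *\<^sub>v z) + ?G *\<^sub>v (A *\<^sub>v z) + ?G *\<^sub>v (X *\<^sub>v z))))"
    then have "i < n" using carrier_vecD[OF c(7)] by simp
    then show "(ils_M J A *\<^sub>v z) $ i = ((?G *\<^sub>v r + ?H *\<^sub>v u) + (?G *\<^sub>v u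
      - (?H *\<^sub>v (X *\<^sub>v z) + ?G *\<^sub>v (A *\<^sub>v z) + ?G *\<^sub>v (X *\<^sub>v z)))) $ i"
      using arg_cong[OF eq, of "\<lambda>v. v $ i"] c[THEN carrier_vecD]
      by (simp del: index_mult_mat_vec dim_mult_mat_vec)
  qed (use c[THEN carrier_vecD] in \<open>simp del: dim_mult_mat_vec\<close>)
qed

section \<open>Differentiability of the solution map\<close>

lemma ils_g_has_frechet_derivative:
  fixes A J L :: "real mat" and b :: "real vec"
  assumes A: "A \<in> carrier_mat m n" and J: "J \<in> carrier_mat m m" and L: "L \<in> carrier_mat n k"
    and b: "b \<in> carrier_vec m"
    and nonsing: "\<forall>v\<in>carrier_vec n. ils_M J A *\<^sub>v v = 0\<^sub>v n \<longrightarrow> v = 0\<^sub>v n"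
  shows "has_frechet_derivative (ils_g J L) (\<lambda>X y. ils_Mg' J L A b *\<^sub>v vec_pair X y) A b"
proof -
  let ?Mi = "ils_Minv J A" and ?H = "transpose_mat A * J"
  define K where "K = transpose_mat L * ?Mi"
  define x where "x = ils_x J A b"
  define r where "r = ils_r J A b"
  \<comment> \<open>For a perturbation of size \<open>h \<le> 1\<close>: \<open>c1 * h\<close>
    bounds \<open>u\<close>, \<open>c2 * h * vnorm_inf v\<close> bounds the change of M at
    \<open>v\<close>, and \<open>c3 * h\<close> bounds \<open>lin\<close> together with
    \<open>?G *\<^sub>v u\<close>. Then \<open>2 * \<mu> * c3 * h\<close> bounds \<open>z\<close>,
    and \<open>C * h * h\<close> bounds the final remainder.\<close>
  define \<mu> where "\<mu> = mnorm_inf ?Mi"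
  define \<eta> where "\<eta> = mnorm_inf ?H"
  define \<gamma> where "\<gamma> = m * mnorm_inf J"
  define c1 where "c1 = 1 + n * vnorm_inf x"
  define c2 where "c2 = \<eta> * n + \<gamma> * mnorm_inf A + \<gamma> * n"
  define c3 where "c3 = \<gamma> * vnorm_inf r + \<eta> * c1 + \<gamma> * c1"
  define C where "C = mnorm_inf K * (\<gamma> * c1 + c2 * (2 * \<mu> * c3))"
  have \<mu>: "0 \<le> \<mu>" and \<eta>: "0 \<le> \<eta>" and \<gamma>: "0 \<le> \<gamma>" and c1: "0 \<le> c1"
    by (simp_all add: \<mu>_def \<eta>_def \<gamma>_def c1_def)
  have c2: "0 \<le> c2" and c3: "0 \<le> c3"
    using \<eta> \<gamma> c1 by (simp_all add: c2_def c3_def)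
  have "0 \<le> C" using \<mu> \<gamma> c1 c2 c3 by (simp add: C_def)
  note nn = \<mu> \<eta> \<gamma> c1 c2 c3 this
  note Mi = ils_Minv[OF A J nonsing]
  have M: "ils_M J A \<in> carrier_mat n n" by (rule ils_M_carrier[OF A J])
  have K: "K \<in> carrier_mat k n" unfolding K_def using L Mi(1) by simp
  have H: "?H \<in> carrier_mat n m" using A J by simp
  have Mg: "ils_Mg' J L A b \<in> carrier_mat k (n * m + m)"
    by (rule ils_Mg'_carrier[OF A J L Mi(1)])
  have x: "x \<in> carrier_vec n" unfolding x_def by (rule ils_x_carrier[OF A J nonsing b])
  have r: "r \<in> carrier_vec m" unfolding r_def by (rule ils_r_carrier[OF A J nonsing b])
  have dim: "dim_vec (ils_g J L A b) = k" using L by (simp add: ils_g_def)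
  have Mi_M: "?Mi *\<^sub>v (ils_M J A *\<^sub>v v) = v" if "v \<in> carrier_vec n" for v
    using assoc_mult_mat_vec[OF Mi(1) M that] Mi(3) that by simp
  \<comment> \<open>This lower bound for M drives both absorption arguments below.\<close>
  have nMi: "vnorm_inf v \<le> \<mu> * vnorm_inf (ils_M J A *\<^sub>v v)" if v: "v \<in> carrier_vec n" for v
    unfolding \<mu>_def
    using vnorm_inf_mult_mat_vec[of "ils_M J A *\<^sub>v v" ?Mi] Mi_M[OF v] Mi(1) M by simp
  have approx: "\<exists>d>0. \<forall>X\<in>carrier_mat m n. \<forall>y\<in>carrier_vec m. vnorm_inf (vec_pair X y) < d \<longrightarrow>
      vnorm_inf (ils_g J L (A + X) (b + y) - ils_g J L A b - ils_Mg' J L A b *\<^sub>v vec_pair X y)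
        \<le> e * vnorm_inf (vec_pair X y)" if e: "e > 0" for e
  proof -
    \<comment> \<open>The first entry ensures \<open>h \<le> 1\<close>, the second that the change
      of M costs at most half of a vector's norm, the third that \<open>C * h \<le> e\<close>.
      Adding 1 keeps the denominators positive when \<open>\<mu> * c2\<close> or \<open>C\<close> is
      0.\<close>
    define d where "d = min 1 (min (1 / (2 * (\<mu> * c2 + 1))) (e / (C + 1)))"
    have "0 \<le> \<mu> * c2" using nn by simp
    then have pos1: "0 < 2 * (\<mu> * c2 + 1)" by (intro mult_pos_pos add_nonneg_pos) simp_all
    have pos2: "0 < C + 1" using nn by linarith
    note pos = pos1 pos2
    have d: "d > 0" unfolding d_def using e pos by (simp only: min_less_iff_conj divide_pos_pos zero_less_one simp_thms)
    have "vnorm_inf (ils_g J L (A + X) (b + y) - ils_g J L A b - ils_Mg' J L A b *\<^sub>v vec_pair X y)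
        \<le> e * vnorm_inf (vec_pair X y)"
      if X: "X \<in> carrier_mat m n" and y: "y \<in> carrier_vec m" and less: "vnorm_inf (vec_pair X y) < d" for X y
    proof -
      define h where "h = vnorm_inf (vec_pair X y)"
      let ?G = "transpose_mat X * J"
      have h: "0 \<le> h" "h \<le> 1" using less unfolding h_def d_def by auto
      have "h < 1 / (2 * (\<mu> * c2 + 1))" and "h < e / (C + 1)" using less unfolding h_def d_def by auto
      then have "h * (2 * (\<mu> * c2 + 1)) < 1" "h * (C + 1) < e"
        using pos by (simp_all only: pos_less_divide_eq)
      then have half: "\<mu> * (c2 * h) \<le> 1 / 2" and Ch: "C * h \<le> e"
        using h by (simp_all add: algebra_simps)
      have hX: "mnorm_inf X \<le> n * h" and hXt: "mnorm_inf (transpose_mat X) \<le> m * h"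
        unfolding h_def by (rule mnorm_inf_le_vnorm_inf_vec_pair[OF X y])+
      have hy: "vnorm_inf y \<le> h" unfolding h_def by (rule vnorm_inf_le_vnorm_inf_vec_pair[OF X y])
      have G: "?G \<in> carrier_mat n m" using X J by simp
      have AX: "A + X \<in> carrier_mat m n" using A X by simp
      have by': "b + y \<in> carrier_vec m" using b y by simp
      have E: "vnorm_inf (ils_M_diff J A X v) \<le> c2 * h * vnorm_inf v" if "v \<in> carrier_vec n" for v
        unfolding c2_def \<eta>_def \<gamma>_def by (rule vnorm_inf_ils_M_diff[OF A X J that hX hXt h])
      \<comment> \<open>By \<open>half\<close> the last term is at most half the norm of
        \<open>v\<close>, so moving it to the left costs a factor 2.\<close>
      have absorb: "vnorm_inf v \<le> 2 * s" if "vnorm_inf v \<le> s + \<mu> * (c2 * h * vnorm_inf v)" for v s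
        using mult_right_mono[OF half vnorm_inf_nonneg[of v]] that by (simp add: mult.assoc)
      \<comment> \<open>\<open>ils_x\<close> at the perturbed data uses
        \<open>the (mat_inverse ...)\<close>, which must first be shown to be an inverse. A kernel
        vector satisfies M v = - \<open>ils_M_diff J A X v\<close>, and \<open>absorb\<close> with
        \<open>s = 0\<close> makes it vanish.\<close>
      have nonsing': "\<forall>v\<in>carrier_vec n. ils_M J (A + X) *\<^sub>v v = 0\<^sub>v n \<longrightarrow> v = 0\<^sub>v n"
      proof (intro ballI impI)
        fix v assume v: "v \<in> carrier_vec n" and Mv: "ils_M J (A + X) *\<^sub>v v = 0\<^sub>v n"
        have "ils_M J A *\<^sub>v v + ils_M_diff J A X v = 0\<^sub>v n"
          using Mv ils_M_add_mult_vec[OF A X J v] by simp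
        then have "ils_M J A *\<^sub>v v = (- 1) \<cdot>\<^sub>v ils_M_diff J A X v"
          using carrier_matD[OF M] carrier_vecD[OF ils_M_diff_carrier[OF A X J, of v]]
          by (auto simp: vec_eq_iff eq_neg_iff_add_eq_0 simp del: index_mult_mat_vec)
        then have "vnorm_inf v \<le> \<mu> * vnorm_inf (ils_M_diff J A X v)"
          using nMi[OF v] vnorm_inf_smult[of "- 1"] by simp
        also have "\<dots> \<le> \<mu> * (c2 * h * vnorm_inf v)" by (intro mult_left_mono E v nn)
        finally have "vnorm_inf v \<le> 2 * 0" by (intro absorb) simp
        then have "vnorm_inf v = 0" using vnorm_inf_nonneg[of v] by linarith
        then show "v = 0\<^sub>v n" using v by (simp add: vnorm_inf_zero_iff)
      qed
      define u where "u = y - X *\<^sub>v x"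
      define z where "z = ils_x J (A + X) (b + y) - x"
      define lin where "lin = ?G *\<^sub>v r + ?H *\<^sub>v u"
      define rest where "rest = ?G *\<^sub>v u - ils_M_diff J A X z"
      have u: "u \<in> carrier_vec m" unfolding u_def using X x y by simp
      have x': "ils_x J (A + X) (b + y) \<in> carrier_vec n" by (rule ils_x_carrier[OF AX J nonsing' by'])
      have z: "z \<in> carrier_vec n" unfolding z_def using x x' by simp
      have Gr: "?G *\<^sub>v r \<in> carrier_vec n" and Hu: "?H *\<^sub>v u \<in> carrier_vec n" and Gu: "?G *\<^sub>v u \<in> carrier_vec n"
        by (rule mult_mat_vec_carrier[OF G r] mult_mat_vec_carrier[OF H u] mult_mat_vec_carrier[OF G u])+
      have Ez: "ils_M_diff J A X z \<in> carrier_vec n" by (rule ils_M_diff_carrier[OF A X J])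
      have lin: "lin \<in> carrier_vec n" and rest: "rest \<in> carrier_vec n"
        unfolding lin_def rest_def using Gr Hu Gu Ez by auto
      have Mz: "ils_M J A *\<^sub>v z = lin + rest"
        unfolding lin_def rest_def z_def u_def r_def x_def
        by (rule ils_M_mult_solution_diff[OF A X J b y nonsing nonsing'])
      have nu: "vnorm_inf u \<le> c1 * h"
      proof -
        have "vnorm_inf u \<le> vnorm_inf y + vnorm_inf (X *\<^sub>v x)"
          unfolding u_def using X x y by (intro vnorm_inf_diff[of _ m]) auto
        also have "vnorm_inf (X *\<^sub>v x) \<le> mnorm_inf X * vnorm_inf x"
          using X x by (intro vnorm_inf_mult_mat_vec) simp
        also have "\<dots> \<le> n * h * vnorm_inf x" by (intro mult_right_mono hX) simp
        finally show ?thesis using hy by (simp add: c1_def algebra_simps)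
      qed
      have nG: "vnorm_inf (?G *\<^sub>v w) \<le> \<gamma> * h * vnorm_inf w" if "w \<in> carrier_vec m" for w
        using vnorm_inf_transpose_mult[OF X J that hXt] by (simp add: \<gamma>_def mult_ac)
      \<comment> \<open>Two forms are kept: the quadratic one enters the remainder, the weaker
        linear one \<open>nGu1\<close> enters the bound for \<open>z\<close>.\<close>
      have nGu: "vnorm_inf (?G *\<^sub>v u) \<le> \<gamma> * c1 * h * h"
        using nG[OF u] mult_left_mono[OF nu, of "\<gamma> * h"] nn h by (simp add: mult_ac)
      also have "\<dots> \<le> \<gamma> * c1 * h * 1" using nn h by (intro mult_left_mono) auto
      finally have nGu1: "vnorm_inf (?G *\<^sub>v u) \<le> \<gamma> * c1 * h" by simp
      have "vnorm_inf (?H *\<^sub>v u) \<le> \<eta> * vnorm_inf u"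
        unfolding \<eta>_def by (rule vnorm_inf_mult_mat_vec) (use carrier_matD[OF H] u in simp)
      also have "\<dots> \<le> \<eta> * (c1 * h)" by (intro mult_left_mono nu nn)
      finally have nHu: "vnorm_inf (?H *\<^sub>v u) \<le> \<eta> * (c1 * h)" .
      have nlin: "vnorm_inf lin \<le> vnorm_inf (?G *\<^sub>v r) + vnorm_inf (?H *\<^sub>v u)"
        unfolding lin_def by (rule vnorm_inf_add[OF Gr Hu])
      have nrest: "vnorm_inf rest \<le> vnorm_inf (?G *\<^sub>v u) + vnorm_inf (ils_M_diff J A X z)"
        unfolding rest_def by (rule vnorm_inf_diff[OF Gu Ez])
      have "vnorm_inf (lin + rest) \<le> c3 * h + c2 * h * vnorm_inf z"
        using vnorm_inf_add[OF lin rest] nlin nrest nG[OF r] nHu nGu1 E[OF z]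
        by (simp add: c3_def algebra_simps)
      then have "\<mu> * vnorm_inf (ils_M J A *\<^sub>v z) \<le> \<mu> * (c3 * h + c2 * h * vnorm_inf z)"
        unfolding Mz by (intro mult_left_mono nn)
      then have "vnorm_inf z \<le> \<mu> * (c3 * h) + \<mu> * (c2 * h * vnorm_inf z)"
        using nMi[OF z] by (simp add: distrib_left)
      then have nz: "vnorm_inf z \<le> 2 * (\<mu> * (c3 * h))" by (rule absorb)
      have "vnorm_inf (ils_M_diff J A X z) \<le> c2 * h * (2 * (\<mu> * (c3 * h)))"
        using E[OF z] mult_left_mono[OF nz, of "c2 * h"] nn h by simp
      then have nrest': "vnorm_inf rest \<le> (\<gamma> * c1 + c2 * (2 * \<mu> * c3)) * h * h"
        using nrest nGu by (simp add: algebra_simps)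
      have Lt: "transpose_mat L \<in> carrier_mat k n" using L by simp
      have "ils_g J L (A + X) (b + y) - ils_g J L A b = transpose_mat L *\<^sub>v z"
        unfolding ils_g_def z_def x_def[symmetric]
        by (rule mult_minus_distrib_mat_vec[OF Lt x' x, symmetric])
      \<comment> \<open>Inserting M^-1 M before \<open>z\<close> makes the equation for M z
        applicable.\<close>
      also have "\<dots> = K *\<^sub>v (lin + rest)"
        unfolding K_def assoc_mult_mat_vec[OF Lt Mi(1) add_carrier_vec[OF lin rest]]
        using Mi_M[OF z] Mz by simp
      also have "\<dots> = K *\<^sub>v lin + K *\<^sub>v rest" by (rule mult_add_distrib_mat_vec[OF K lin rest])
      finally have diff: "ils_g J L (A + X) (b + y) - ils_g J L A b = K *\<^sub>v lin + K *\<^sub>v rest" .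
      have Klin: "ils_Mg' J L A b *\<^sub>v vec_pair X y = K *\<^sub>v lin"
        unfolding K_def lin_def r_def u_def x_def
        by (rule ils_Mg'_mult_vec_pair[OF A J L Mi(1) b X y])
      have "ils_g J L (A + X) (b + y) - ils_g J L A b - ils_Mg' J L A b *\<^sub>v vec_pair X y = K *\<^sub>v rest"
        unfolding diff Klin by (intro eq_vecI) (simp_all del: index_mult_mat_vec)
      also have "vnorm_inf \<dots> \<le> mnorm_inf K * vnorm_inf rest"
        using K rest by (intro vnorm_inf_mult_mat_vec) simp
      also have "\<dots> \<le> mnorm_inf K * ((\<gamma> * c1 + c2 * (2 * \<mu> * c3)) * h * h)"
        by (intro mult_left_mono nrest') simp
      also have "\<dots> = C * h * h" by (simp add: C_def mult.assoc)
      also have "\<dots> \<le> e * h" by (intro mult_right_mono Ch h)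
      finally show ?thesis unfolding h_def .
    qed
    then show ?thesis using d by blast
  qed
  have lin_add: "ils_Mg' J L A b *\<^sub>v vec_pair (X + X') (y + y')
      = ils_Mg' J L A b *\<^sub>v vec_pair X y + ils_Mg' J L A b *\<^sub>v vec_pair X' y'"
    if "X \<in> carrier_mat m n" "y \<in> carrier_vec m" "X' \<in> carrier_mat m n" "y' \<in> carrier_vec m" for X X' y y'
    unfolding vec_pair_add[OF that] using that by (intro mult_add_distrib_mat_vec[OF Mg]) auto
  have lin_smult: "ils_Mg' J L A b *\<^sub>v vec_pair (c \<cdot>\<^sub>m X) (c \<cdot>\<^sub>v y) = c \<cdot>\<^sub>v (ils_Mg' J L A b *\<^sub>v vec_pair X y)"
    if "X \<in> carrier_mat m n" "y \<in> carrier_vec m" for X y c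
    unfolding vec_pair_smult[OF that] using that by (intro mult_mat_vec[OF Mg]) auto
  have range: "ils_Mg' J L A b *\<^sub>v vec_pair X y \<in> carrier_vec k" for X y
    by (rule carrier_vecI) (use carrier_matD[OF Mg] in simp)
  show ?thesis
    unfolding has_frechet_derivative_def Let_def dim carrier_matD[OF A] carrier_vecD[OF b]
    using lin_add lin_smult range approx by blast
qed

section \<open>Formulas for the condition numbers\<close>

text \<open>Admissible perturbations have the dimensions of \<open>A\<close> and \<open>b\<close>,
  where the derivative is unique, so the chosen \<open>frechet_deriv\<close> may be replaced by the
  action of \<open>ils_Mg'\<close> inside the supremum.\<close>

lemma kappa_inf_ILS_eq:
  assumes A: "A \<in> carrier_mat m n" and J: "J \<in> carrier_mat m m" and L: "L \<in> carrier_mat n k"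
    and b: "b \<in> carrier_vec m" and pd: "pos_def_mat (ils_M J A)"
    and \<Psi>: "\<Psi> \<in> carrier_mat m n" and \<beta>: "\<beta> \<in> carrier_vec m" and \<xi>: "\<xi> \<in> carrier_vec k"
  shows "kappa_inf_ILS J L \<Psi> \<beta> \<xi> A b
      = ennreal (mnorm_inf (diag_ddag \<xi> * ils_Mg' J L A b * diag_vec (vec_pair \<Psi> \<beta>)))" (is ?th1)
    and "kappa_inf_ILS J L \<Psi> \<beta> \<xi> A b
      = ennreal (vnorm_inf (vec_divide (mabs (ils_Mg' J L A b) *\<^sub>v vabs (vec_pair \<Psi> \<beta>)) (vabs \<xi>)))" (is ?th2)
proof -
  note nonsing = pos_def_mat_nonsingular[OF pd ils_M_carrier[OF A J]]
  have Mg: "ils_Mg' J L A b \<in> carrier_mat k (n * m + m)"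
    by (rule ils_Mg'_carrier[OF A J L ils_Minv(1)[OF A J nonsing]])
  have "kappa_inf_ILS J L \<Psi> \<beta> \<xi> A b = (SUP (X, y) \<in> admissible_pert \<Psi> \<beta>.
        ennreal (vnorm_inf (vec_divide (ils_Mg' J L A b *\<^sub>v vec_pair X y) \<xi>)
                 / vnorm_inf (vec_pair (mat_divide X \<Psi>) (vec_divide y \<beta>))))"
    unfolding kappa_inf_ILS_def
  proof (intro SUP_cong refl, clarify)
    fix X y assume "(X, y) \<in> admissible_pert \<Psi> \<beta>"
    then have "X \<in> carrier_mat (dim_row A) (dim_col A)" "y \<in> carrier_vec (dim_vec b)"
      unfolding admissible_pert_iff[OF \<Psi> \<beta>] using A b by auto
    then have "frechet_deriv (ils_g J L) A b X y = ils_Mg' J L A b *\<^sub>v vec_pair X y"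
      by (rule frechet_deriv_eq[OF ils_g_has_frechet_derivative[OF A J L b nonsing]])
    then show "ennreal (vnorm_inf (vec_divide (frechet_deriv (ils_g J L) A b X y) \<xi>)
                 / vnorm_inf (vec_pair (mat_divide X \<Psi>) (vec_divide y \<beta>)))
      = ennreal (vnorm_inf (vec_divide (ils_Mg' J L A b *\<^sub>v vec_pair X y) \<xi>)
                 / vnorm_inf (vec_pair (mat_divide X \<Psi>) (vec_divide y \<beta>)))"
      by simp
  qed
  then show th1: ?th1 by (simp only: SUP_admissible_pert[OF Mg \<xi> \<Psi> \<beta>])
  have "vec_pair \<Psi> \<beta> \<in> carrier_vec (n * m + m)" using \<Psi> \<beta> by simp
  then show ?th2
    unfolding th1 by (simp only: mnorm_inf_eq_vnorm_inf_abs[OF Mg \<xi>])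
qed

theorem theorem3p8:
  fixes m n k p q :: nat
    and A L \<Psi> J :: "real mat"
    and b \<beta> \<xi> :: "real vec"
  assumes "A \<in> carrier_mat m n" and "n \<le> m"
    and "b \<in> carrier_vec m"
    and "p + q = m" and "J = signature_mat p q"
    and "pos_def_mat (ils_M J A)"
    and "L \<in> carrier_mat n k" and "k \<le> n"
    and "\<Psi> \<in> carrier_mat m n" and "\<beta> \<in> carrier_vec m" and "\<xi> \<in> carrier_vec k"
  shows "kappa_inf_ILS J L \<Psi> \<beta> \<xi> A b
      = ennreal (mnorm_inf (diag_ddag \<xi> * ils_Mg' J L A b * diag_vec (vec_pair \<Psi> \<beta>)))
    \<and> kappa_inf_ILS J L \<Psi> \<beta> \<xi> A b
      = ennreal (vnorm_inf (vec_divide (mabs (ils_Mg' J L A b) *\<^sub>v vabs (vec_pair \<Psi> \<beta>)) (vabs \<xi>)))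
    \<and> kappa_m_ILS J L A b
      = ennreal (scalar_divide (vnorm_inf (mabs (ils_Mg' J L A b) *\<^sub>v vabs (vec_pair A b)))
                   (vnorm_inf (transpose_mat L *\<^sub>v ils_x J A b)))
    \<and> kappa_c_ILS J L A b
      = ennreal (vnorm_inf (vec_divide (mabs (ils_Mg' J L A b) *\<^sub>v vabs (vec_pair A b))
                   (vabs (transpose_mat L *\<^sub>v ils_x J A b))))"
proof -
  have J: "J \<in> carrier_mat m m"
    using assms(4,5) by (auto simp: signature_mat_def)
  note kappa = kappa_inf_ILS_eq[OF assms(1) J assms(7,3,6)]
  let ?c = "vnorm_inf (transpose_mat L *\<^sub>v ils_x J A b)"
  have Lx: "transpose_mat L *\<^sub>v ils_x J A b \<in> carrier_vec k"
    by (rule carrier_vecI) (use assms(7) in simp)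
  have Mg: "mabs (ils_Mg' J L A b) *\<^sub>v vabs (vec_pair A b) \<in> carrier_vec k"
    by (rule carrier_vecI) (use assms(7) in \<open>simp add: ils_Mg'_def Let_def append_cols_def kronecker_def mat_of_row_def ils_Minv_def\<close>)
  have "kappa_m_ILS J L A b = ennreal (scalar_divide (vnorm_inf (mabs (ils_Mg' J L A b) *\<^sub>v vabs (vec_pair A b))) ?c)"
    using kappa(2)[OF assms(1,3), of "vec k (\<lambda>_. ?c)"] vnorm_inf_vec_divide_const[OF _ Mg, of ?c] assms(7)
    by (simp add: kappa_m_ILS_def)
  then show ?thesis
    using kappa[OF assms(9-11)] kappa(2)[OF assms(1,3) Lx] by (simp add: kappa_c_ILS_def)
qed

end
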